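(* Let $(A,\Phi)$ be an $\ell$EAS and let $\mathbf{As}_\Phi$ be the nonsymmetric operad of $\Phi$-associative algebras. For any $n\geqslant 1$, $\mathbf{As}_\Phi(n)$ is the vector space $A^{\otimes(n-1)}$. For any $a_k\ldots a_1\in A^{\otimes k}=\mathbf{As}_\Phi(k+1)$, for any $b_l\ldots b_1\in A^{\otimes l}=\mathbf{As}_\Phi(l+1)$ and for any $i\in\{1,\ldots,k+1\}$: $$a_k\ldots a_1\circ_i b_l\ldots b_1=b_l\ldots b_1a_k\ldots a_1\quad\text{if } i=1,$$ and, if $i\geqslant 2$, $$a_k\ldots a_1\circ_i b_l\ldots b_1=a_k\ldots a_i\;\Big[(\Phi\otimes\mathrm{Id}^{\otimes(l-1)})\circ\cdots\circ(\mathrm{Id}^{\otimes(l-1)}\otimes\Phi)(a_{i-1}b_l\ldots b_1)\Big]\;a_{i-2}\ldots a_1,$$ where the composite in the bracket is that of the maps $\mathrm{Id}^{\otimes j}\otimes\Phi\otimes\mathrm{Id}^{\otimes(l-1-j)}$ of $A^{\otimes(l+1)}$, for $0\leqslant j\leqslant l-1$, the map with $j=l-1$ being applied first, then $j=l-2$, and so on, the map with $j=0$ being applied last.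
   Context: All vector spaces are over a field $\mathbb{K}$; tensors $a_k\otimes\cdots\otimes a_1$ are written as words $a_k\ldots a_1$. For a vector space $A$ and a linear map $\Phi:A\otimes A\to A\otimes A$, $(A,\Phi)$ is a linear extended associative semigroup ($\ell$EAS) if $(\mathrm{Id}\otimes\Phi)\circ(\Phi\otimes\mathrm{Id})\circ(\mathrm{Id}\otimes\Phi)=(\Phi\otimes\mathrm{Id})\circ(\mathrm{Id}\otimes\tau)\circ(\Phi\otimes\mathrm{Id})$ on $A^{\otimes 3}$, where $\tau(a\otimes b)=b\otimes a$. One writes symbolically $\Phi(a\otimes b)=\sum a'\rightarrow b'\otimes a''\triangleright b''$. A $\Phi$-associative algebra is a vector space $V$ with bilinear products $*_a$, linear in $a\in A$, such that $x*_a(y*_bz)=\sum(x*_{a''\triangleright b''}y)*_{a'\rightarrow b'}z$ for all $x,y,z\in V$ and $a,b\in A$. $\mathbf{As}_\Phi$ is the nonsymmetric operad generated by $A=\mathbf{As}_\Phi(2)$ with the relations $a\circ_2b=\sum(a'\rightarrow b')\circ_1(a''\triangleright b'')$ for $a,b\in A$; $\circ_i$ denotes the $i$-th partial composition.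
   Formalization: The printed formulas violate operad associativity (e.g. Φ=τ, dim A=2). Proved instead: for i=1 the composition is a_k…a_1 b_l…b_1, and in the bracket for i≥2 the map with j=0 is applied first and the one with j=l−1 last. *)

theory Defs
  imports Complex_Main "HOL-Library.Poly_Mapping" "HOL-Library.Tree"
begin

section \<open>Free vector spaces and their quotients\<close>

text \<open>The vector space with basis \<open>S\<close> is \<open>free_on S\<close>: the finitely supported functions
  \<^typ>\<open>'x \<Rightarrow>\<^sub>0 'k\<close> with support in \<open>S\<close>.\<close>

definition fscale :: "'k::field \<Rightarrow> ('x \<Rightarrow>\<^sub>0 'k) \<Rightarrow> ('x \<Rightarrow>\<^sub>0 'k)" where
  "fscale c x = Poly_Mapping.map (\<lambda>d. c * d) x"

definition free_on :: "'x set \<Rightarrow> ('x \<Rightarrow>\<^sub>0 'k::field) set" where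
  "free_on S = {x. Poly_Mapping.keys x \<subseteq> S}"

definition basis :: "'x \<Rightarrow> ('x \<Rightarrow>\<^sub>0 'k::field)" where
  "basis s = Poly_Mapping.single s 1"

definition lin_ext :: "('x \<Rightarrow> ('y \<Rightarrow>\<^sub>0 'k)) \<Rightarrow> ('x \<Rightarrow>\<^sub>0 'k::field) \<Rightarrow> ('y \<Rightarrow>\<^sub>0 'k)" where
  "lin_ext g x = (\<Sum>s\<in>Poly_Mapping.keys x. fscale (Poly_Mapping.lookup x s) (g s))"

definition bilin_ext ::
  "('x \<Rightarrow> 'y \<Rightarrow> ('z \<Rightarrow>\<^sub>0 'k)) \<Rightarrow> ('x \<Rightarrow>\<^sub>0 'k::field) \<Rightarrow> ('y \<Rightarrow>\<^sub>0 'k) \<Rightarrow> ('z \<Rightarrow>\<^sub>0 'k)" where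
  "bilin_ext g x y = lin_ext (\<lambda>s. lin_ext (g s) y) x"

lemma vector_space_fscale:
  "vector_space (fscale :: 'k::field \<Rightarrow> ('x \<Rightarrow>\<^sub>0 'k) \<Rightarrow> ('x \<Rightarrow>\<^sub>0 'k))"
proof -
  have lookup_fscale: "Poly_Mapping.lookup (fscale c x) s = c * Poly_Mapping.lookup x s"
    for c :: 'k and x :: "'x \<Rightarrow>\<^sub>0 'k" and s
    by (auto simp: fscale_def Poly_Mapping.map.rep_eq when_def)
  show ?thesis
    by unfold_locales
      (auto simp: poly_mapping_eq_iff fun_eq_iff lookup_fscale lookup_add algebra_simps)
qed

text \<open>The elements of a quotient by a subspace \<open>N\<close> are the cosets of \<open>N\<close>. Operations on
  quotients are the unions of the cosets obtained from all representatives, as is usual for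
  quotients by equivalence relations.\<close>

definition coset :: "('x \<Rightarrow>\<^sub>0 'k::field) set \<Rightarrow> ('x \<Rightarrow>\<^sub>0 'k) \<Rightarrow> ('x \<Rightarrow>\<^sub>0 'k) set" where
  "coset N x = {y. y - x \<in> N}"

definition qadd :: "('x \<Rightarrow>\<^sub>0 'k::field) set \<Rightarrow> ('x \<Rightarrow>\<^sub>0 'k) set \<Rightarrow> ('x \<Rightarrow>\<^sub>0 'k) set \<Rightarrow> ('x \<Rightarrow>\<^sub>0 'k) set" where
  "qadd N X Y = (\<Union>x\<in>X. \<Union>y\<in>Y. coset N (x + y))"

definition qscale :: "('x \<Rightarrow>\<^sub>0 'k::field) set \<Rightarrow> 'k \<Rightarrow> ('x \<Rightarrow>\<^sub>0 'k) set \<Rightarrow> ('x \<Rightarrow>\<^sub>0 'k) set" where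
  "qscale N c X = (\<Union>x\<in>X. coset N (fscale c x))"

text \<open>Linear maps from \<open>V\<close> to \<open>W\<close>, where \<open>V\<close> and \<open>W\<close> consist of cosets of \<open>N\<close> and \<open>M\<close>.\<close>

definition qlinear ::
  "('x \<Rightarrow>\<^sub>0 'k::field) set \<Rightarrow> ('x \<Rightarrow>\<^sub>0 'k) set set \<Rightarrow> ('y \<Rightarrow>\<^sub>0 'k) set \<Rightarrow> ('y \<Rightarrow>\<^sub>0 'k) set set
    \<Rightarrow> (('x \<Rightarrow>\<^sub>0 'k) set \<Rightarrow> ('y \<Rightarrow>\<^sub>0 'k) set) \<Rightarrow> bool" where
  "qlinear N V M W f \<longleftrightarrow>
     f ` V \<subseteq> W \<and>
     (\<forall>X\<in>V. \<forall>Y\<in>V. f (qadd N X Y) = qadd M (f X) (f Y)) \<and>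
     (\<forall>c. \<forall>X\<in>V. f (qscale N c X) = qscale M c (f X))"

definition qiso ::
  "('x \<Rightarrow>\<^sub>0 'k::field) set \<Rightarrow> ('x \<Rightarrow>\<^sub>0 'k) set set \<Rightarrow> ('y \<Rightarrow>\<^sub>0 'k) set \<Rightarrow> ('y \<Rightarrow>\<^sub>0 'k) set set
    \<Rightarrow> (('x \<Rightarrow>\<^sub>0 'k) set \<Rightarrow> ('y \<Rightarrow>\<^sub>0 'k) set) \<Rightarrow> bool" where
  "qiso N V M W f \<longleftrightarrow> qlinear N V M W f \<and> bij_betw f V W"


section \<open>Tensor powers\<close>

text \<open>Throughout, the vector space \<open>A\<close> is the type \<^typ>\<open>'a\<close> with scalar multiplication \<open>sc\<close>.
  Its tensor algebra is the vector space with basis all words \<^typ>\<open>'a list\<close>, modulo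
  multilinearity in the letters; the tensor power of exponent \<open>n\<close> is the image of the words of
  length \<open>n\<close>. The list \<open>[x\<^sub>1, \<dots>, x\<^sub>n]\<close> stands for \<open>x\<^sub>1 \<otimes> \<dots> \<otimes> x\<^sub>n\<close>.\<close>

type_synonym ('a, 'k) tensor = "('a list \<Rightarrow>\<^sub>0 'k) set"

definition multilin :: "('k::field \<Rightarrow> 'a::ab_group_add \<Rightarrow> 'a) \<Rightarrow> ('a list \<Rightarrow>\<^sub>0 'k) set" where
  "multilin sc = module.span fscale
     ({basis (u @ [a + b] @ v) - basis (u @ [a] @ v) - basis (u @ [b] @ v) |u a b v. True} \<union>
      {basis (u @ [sc c a] @ v) - fscale c (basis (u @ [a] @ v)) |u c a v. True})"

definition word :: "('k::field \<Rightarrow> 'a::ab_group_add \<Rightarrow> 'a) \<Rightarrow> 'a list \<Rightarrow> ('a, 'k) tensor" where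
  "word sc w = coset (multilin sc) (basis w)"

definition tensor_power :: "('k::field \<Rightarrow> 'a::ab_group_add \<Rightarrow> 'a) \<Rightarrow> nat \<Rightarrow> ('a, 'k) tensor set" where
  "tensor_power sc n = coset (multilin sc) ` free_on {w. length w = n}"

definition free_cat :: "('a list \<Rightarrow>\<^sub>0 'k::field) \<Rightarrow> ('a list \<Rightarrow>\<^sub>0 'k) \<Rightarrow> ('a list \<Rightarrow>\<^sub>0 'k)" where
  "free_cat = bilin_ext (\<lambda>u v. basis (u @ v))"

definition tcat :: "('k::field \<Rightarrow> 'a::ab_group_add \<Rightarrow> 'a)
    \<Rightarrow> ('a, 'k) tensor \<Rightarrow> ('a, 'k) tensor \<Rightarrow> ('a, 'k) tensor" where
  "tcat sc X Y = (\<Union>x\<in>X. \<Union>y\<in>Y. coset (multilin sc) (free_cat x y))"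

definition tflip :: "('k::field \<Rightarrow> 'a::ab_group_add \<Rightarrow> 'a) \<Rightarrow> ('a, 'k) tensor \<Rightarrow> ('a, 'k) tensor" where
  "tflip sc X = (\<Union>x\<in>X. coset (multilin sc) (lin_ext (\<lambda>w. basis (rev w)) x))"

text \<open>For a linear endomorphism \<open>f\<close> of \<open>A \<otimes> A\<close>, \<open>at_slot sc j f\<close> is
  \<open>Id\<^bsup>\<otimes>j\<^esup> \<otimes> f \<otimes> Id\<^bsup>\<otimes>(n-2-j)\<^esup>\<close> on the tensor power of exponent \<open>n\<close>, for every \<open>n \<ge> j + 2\<close>:
  on words, \<open>f\<close> is applied to the letters at the positions \<open>j\<close> and \<open>j + 1\<close>, counted from the left
  and from \<open>0\<close>. The choice of a representative of the image under \<open>f\<close> does not matter, and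
  words with fewer than \<open>j + 2\<close> letters are sent to \<open>0\<close>.\<close>

definition at_slot :: "('k::field \<Rightarrow> 'a::ab_group_add \<Rightarrow> 'a) \<Rightarrow> nat
    \<Rightarrow> (('a, 'k) tensor \<Rightarrow> ('a, 'k) tensor) \<Rightarrow> ('a, 'k) tensor \<Rightarrow> ('a, 'k) tensor" where
  "at_slot sc j f X = (\<Union>x\<in>X. coset (multilin sc) (lin_ext (\<lambda>w.
     if j + 2 \<le> length w
     then free_cat (basis (take j w))
            (free_cat (SOME y. y \<in> f (word sc [w ! j, w ! (j + 1)])) (basis (drop (j + 2) w)))
     else 0) x))"


section \<open>Linear extended associative semigroups\<close>

definition lEAS :: "('k::field \<Rightarrow> 'a::ab_group_add \<Rightarrow> 'a)
    \<Rightarrow> (('a, 'k) tensor \<Rightarrow> ('a, 'k) tensor) \<Rightarrow> bool" where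
  "lEAS sc \<Phi> \<longleftrightarrow>
     vector_space sc \<and>
     qlinear (multilin sc) (tensor_power sc 2) (multilin sc) (tensor_power sc 2) \<Phi> \<and>
     (\<forall>X\<in>tensor_power sc 3.
        at_slot sc 1 \<Phi> (at_slot sc 0 \<Phi> (at_slot sc 1 \<Phi> X)) =
        at_slot sc 0 \<Phi> (at_slot sc 1 (tflip sc) (at_slot sc 0 \<Phi> X)))"


section \<open>The nonsymmetric operad of \<open>\<Phi>\<close>-associative algebras\<close>

text \<open>The free nonsymmetric operad on the set \<^typ>\<open>'a\<close> of binary operations has as a basis the
  planar binary trees with nodes labelled by \<^typ>\<open>'a\<close>; the arity of a tree is its number
  \<^const>\<open>size1\<close> of leaves. \<open>graft i t s\<close> plugs \<open>s\<close> into the \<open>i\<close>-th leaf of \<open>t\<close>, where the leaves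
  are numbered from left to right, starting from \<open>1\<close>.\<close>

fun graft :: "nat \<Rightarrow> 'a tree \<Rightarrow> 'a tree \<Rightarrow> 'a tree" where
  "graft i Leaf s = s"
| "graft i (Node l a r) s =
     (if i \<le> size1 l then Node (graft i l s) a r else Node l a (graft (i - size1 l) r s))"

text \<open>The partial compositions are extended to the direct sum of all arities: \<open>t \<circ>\<^sub>i s = 0\<close>
  if \<open>t\<close> has no \<open>i\<close>-th leaf.\<close>

definition free_comp :: "nat \<Rightarrow> ('a tree \<Rightarrow>\<^sub>0 'k::field) \<Rightarrow> ('a tree \<Rightarrow>\<^sub>0 'k) \<Rightarrow> ('a tree \<Rightarrow>\<^sub>0 'k)" where
  "free_comp i = bilin_ext (\<lambda>t s. if 1 \<le> i \<and> i \<le> size1 t then basis (graft i t s) else 0)"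

inductive_set operadic_ideal :: "('a tree \<Rightarrow>\<^sub>0 'k::field) set \<Rightarrow> ('a tree \<Rightarrow>\<^sub>0 'k) set"
  for R :: "('a tree \<Rightarrow>\<^sub>0 'k) set" where
  gen: "x \<in> R \<Longrightarrow> x \<in> operadic_ideal R"
| zero: "0 \<in> operadic_ideal R"
| add: "x \<in> operadic_ideal R \<Longrightarrow> y \<in> operadic_ideal R \<Longrightarrow> x + y \<in> operadic_ideal R"
| scale: "x \<in> operadic_ideal R \<Longrightarrow> fscale c x \<in> operadic_ideal R"
| comp_left: "x \<in> operadic_ideal R \<Longrightarrow> free_comp i x y \<in> operadic_ideal R"
| comp_right: "y \<in> operadic_ideal R \<Longrightarrow> free_comp i x y \<in> operadic_ideal R"

abbreviation corolla :: "'a \<Rightarrow> ('a tree \<Rightarrow>\<^sub>0 'k::field)" where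
  "corolla a \<equiv> basis (Node Leaf a Leaf)"

text \<open>Dividing out the first two families of relations turns the free operad on the set
  \<^typ>\<open>'a\<close> into the free operad on the vector space \<open>A\<close>. The third family expresses
  \<open>a \<circ>\<^sub>2 b = \<Sum> (a' \<rightarrow> b') \<circ>\<^sub>1 (a'' \<triangleright> b'')\<close>, where \<open>f\<close> runs over all ways of writing
  \<open>\<Phi>(a \<otimes> b)\<close> as a sum \<open>\<Sum> (a' \<rightarrow> b') \<otimes> (a'' \<triangleright> b'')\<close>.\<close>

definition As_rels :: "('k::field \<Rightarrow> 'a::ab_group_add \<Rightarrow> 'a)
    \<Rightarrow> (('a, 'k) tensor \<Rightarrow> ('a, 'k) tensor) \<Rightarrow> ('a tree \<Rightarrow>\<^sub>0 'k) set" where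
  "As_rels sc \<Phi> =
     {corolla (a + b) - corolla a - corolla b |a b. True} \<union>
     {corolla (sc c a) - fscale c (corolla a) |c a. True} \<union>
     {free_comp 2 (corolla a) (corolla b) - lin_ext (\<lambda>w. free_comp 1 (corolla (w ! 0)) (corolla (w ! 1))) f
        |a b f.
        f \<in> free_on {w. length w = 2} \<and> f \<in> \<Phi> (word sc [a, b])}"

definition As_ideal :: "('k::field \<Rightarrow> 'a::ab_group_add \<Rightarrow> 'a)
    \<Rightarrow> (('a, 'k) tensor \<Rightarrow> ('a, 'k) tensor) \<Rightarrow> ('a tree \<Rightarrow>\<^sub>0 'k) set" where
  "As_ideal sc \<Phi> = operadic_ideal (As_rels sc \<Phi>)"

definition As :: "('k::field \<Rightarrow> 'a::ab_group_add \<Rightarrow> 'a)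
    \<Rightarrow> (('a, 'k) tensor \<Rightarrow> ('a, 'k) tensor) \<Rightarrow> nat \<Rightarrow> ('a tree \<Rightarrow>\<^sub>0 'k) set set" where
  "As sc \<Phi> n = coset (As_ideal sc \<Phi>) ` free_on {t. size1 t = n}"

definition As_comp :: "('k::field \<Rightarrow> 'a::ab_group_add \<Rightarrow> 'a)
    \<Rightarrow> (('a, 'k) tensor \<Rightarrow> ('a, 'k) tensor)
    \<Rightarrow> nat \<Rightarrow> ('a tree \<Rightarrow>\<^sub>0 'k) set \<Rightarrow> ('a tree \<Rightarrow>\<^sub>0 'k) set \<Rightarrow> ('a tree \<Rightarrow>\<^sub>0 'k) set" where
  "As_comp sc \<Phi> i X Y = (\<Union>x\<in>X. \<Union>y\<in>Y. coset (As_ideal sc \<Phi>) (free_comp i x y))"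

definition As_unit :: "('k::field \<Rightarrow> 'a::ab_group_add \<Rightarrow> 'a)
    \<Rightarrow> (('a, 'k) tensor \<Rightarrow> ('a, 'k) tensor) \<Rightarrow> ('a tree \<Rightarrow>\<^sub>0 'k) set" where
  "As_unit sc \<Phi> = coset (As_ideal sc \<Phi>) (basis Leaf)"

definition As_gen :: "('k::field \<Rightarrow> 'a::ab_group_add \<Rightarrow> 'a)
    \<Rightarrow> (('a, 'k) tensor \<Rightarrow> ('a, 'k) tensor) \<Rightarrow> 'a \<Rightarrow> ('a tree \<Rightarrow>\<^sub>0 'k) set" where
  "As_gen sc \<Phi> a = coset (As_ideal sc \<Phi>) (corolla a)"


section \<open>Words with decreasing indices\<close>

text \<open>The list \<open>[a\<^sub>p, a\<^sub>p\<^sub>-\<^sub>1, \<dots>, a\<^sub>q]\<close>, which is empty if \<open>p < q\<close>.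

  Pitfall: if composing at leaf \<open>i \<ge> 2\<close> lets the letter \<open>a\<^sub>i\<^sub>-\<^sub>1\<close> of \<open>a\<^sub>k \<dots> a\<^sub>1\<close> act on the inserted
  word, then \<open>a\<^sub>k \<dots> a\<^sub>1\<close> is the left comb with \<open>a\<^sub>k\<close> at the root and \<open>a\<^sub>1\<close> innermost. Hence
  \<open>a \<circ>\<^sub>1 b = ab\<close>, and \<open>a\<^sub>i\<^sub>-\<^sub>1\<close> meets \<open>b\<^sub>l\<close> first and \<open>b\<^sub>1\<close> last. With \<open>a \<circ>\<^sub>1 b = ba\<close>, or with the
  maps \<open>Id\<^bsup>\<otimes>j\<^esup> \<otimes> \<Phi> \<otimes> Id\<^bsup>\<otimes>(l-1-j)\<^esup>\<close> applied in the opposite order, the associativity of an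
  operad fails, for instance for \<open>\<Phi> = \<tau>\<close> in dimension \<open>2\<close>.\<close>

definition letters :: "(nat \<Rightarrow> 'a) \<Rightarrow> nat \<Rightarrow> nat \<Rightarrow> 'a list" where
  "letters a p q = map a (rev [q..<Suc p])"

end

theory Submission
  imports Defs
begin

text \<open>The word \<open>a\<^sub>k \<dots> a\<^sub>1\<close> corresponds to the left comb with \<open>a\<^sub>k\<close> at the root, and the relation
  \<open>a \<circ>\<^sub>2 b = \<Sum> (a' \<rightarrow> b') \<circ>\<^sub>1 (a'' \<triangleright> b'')\<close>, read from left to right, straightens every tree into a
  combination of left combs. For the converse, the result \<open>nf t\<close> of one fixed straightening
  procedure is defined on all trees \<open>t\<close> by recursion, and its linear extension is shown to send
  the operadic ideal into the multilinearity relations. Closure under composition at the leaves of an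
  element of the ideal requires \<open>nf (t \<circ>\<^sub>i s)\<close> to depend on \<open>nf t\<close> only; this comes down to one
  identity, in which a letter acts on a word on which another letter has already acted, and that
  identity is where the axiom on \<open>\<Phi>\<close> is used.

  All computations take place in free vector spaces with chosen representatives \<open>\<phi> a b\<close> of
  \<open>\<Phi>(a \<otimes> b)\<close>; congruence modulo a subspace \<open>N\<close> is written as an equality of cosets of \<open>N\<close>.\<close>


section \<open>Linear maps between free vector spaces and their cosets\<close>

interpretation fs: vector_space "fscale :: 'k::field \<Rightarrow> ('x \<Rightarrow>\<^sub>0 'k) \<Rightarrow> ('x \<Rightarrow>\<^sub>0 'k)"
  by (rule vector_space_fscale)

lemma lookup_fscale [simp]: "Poly_Mapping.lookup (fscale c x) s = c * Poly_Mapping.lookup x s"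
  by (auto simp: fscale_def Poly_Mapping.map.rep_eq when_def)

abbreviation flinear :: "(('x \<Rightarrow>\<^sub>0 'k::field) \<Rightarrow> ('y \<Rightarrow>\<^sub>0 'k)) \<Rightarrow> bool" where
  "flinear \<equiv> module_hom fscale fscale"

lemma flinearI:
  assumes "\<And>x y. f (x + y) = f x + f y" "\<And>c x. f (fscale c x) = fscale c (f x)"
  shows "flinear f"
  using assms by unfold_locales auto

lemmas flinear_add = module_hom.add [where ?s1.0 = fscale and ?s2.0 = fscale]
lemmas flinear_diff = module_hom.diff [where ?s1.0 = fscale and ?s2.0 = fscale]
lemmas flinear_zero = module_hom.zero [where ?s1.0 = fscale and ?s2.0 = fscale]
lemmas flinear_scale = module_hom.scale [where ?s1.0 = fscale and ?s2.0 = fscale]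
lemmas flinear_sum = module_hom.sum [where ?s1.0 = fscale and ?s2.0 = fscale]

lemma flinear_compose: "flinear f \<Longrightarrow> flinear g \<Longrightarrow> flinear (\<lambda>x. f (g x))"
  by (intro flinearI) (auto simp: flinear_add flinear_scale)

lemma flinear_id: "flinear (\<lambda>x. x)"
  by (intro flinearI) auto

lemma lin_ext_superset:
  assumes "finite S" "Poly_Mapping.keys x \<subseteq> S"
  shows "lin_ext g x = (\<Sum>s\<in>S. fscale (Poly_Mapping.lookup x s) (g s))"
  unfolding lin_ext_def using assms
  by (intro sum.mono_neutral_left) (auto simp: in_keys_iff)

lemma flinear_lin_ext:
  fixes g :: "'x \<Rightarrow> ('y \<Rightarrow>\<^sub>0 'k::field)"
  shows "flinear (lin_ext g)"
proof (rule flinearI)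
  fix x y :: "'x \<Rightarrow>\<^sub>0 'k"
  let ?S = "Poly_Mapping.keys x \<union> Poly_Mapping.keys y"
  have "Poly_Mapping.keys (x + y) \<subseteq> ?S"
    by (rule Poly_Mapping.keys_add)
  then show "lin_ext g (x + y) = lin_ext g x + lin_ext g y"
    by (simp add: lin_ext_superset [of ?S] lookup_add fs.scale_left_distrib sum.distrib)
next
  fix c and x :: "'x \<Rightarrow>\<^sub>0 'k"
  have "Poly_Mapping.keys (fscale c x) \<subseteq> Poly_Mapping.keys x"
    by (auto simp: in_keys_iff)
  then show "lin_ext g (fscale c x) = fscale c (lin_ext g x)"
    by (simp add: lin_ext_superset [of "Poly_Mapping.keys x"] fs.scale_sum_right)
qed

lemma lin_ext_basis [simp]: "lin_ext g (basis s) = g s"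
  by (simp add: lin_ext_def basis_def)

lemma lin_ext_zero_fun [simp]: "lin_ext (\<lambda>s. 0) x = 0"
  by (simp add: lin_ext_def)

lemma lin_ext_zero [simp]: "lin_ext g 0 = 0"
  by (simp add: lin_ext_def)

lemma lin_ext_add_fun: "lin_ext (\<lambda>s. g s + h s) x = lin_ext g x + lin_ext h x"
  by (simp add: lin_ext_def fs.scale_right_distrib sum.distrib)

lemma lin_ext_scale_fun: "lin_ext (\<lambda>s. fscale c (g s)) x = fscale c (lin_ext g x)"
  by (simp add: lin_ext_def fs.scale_sum_right mult.commute)

lemma flinear_push: "flinear L \<Longrightarrow> L (lin_ext g x) = lin_ext (\<lambda>s. L (g s)) x"
  by (simp add: lin_ext_def flinear_sum flinear_scale)

lemma lin_ext_basis_id [simp]: "lin_ext basis x = x"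
proof (rule poly_mapping_eqI)
  fix s
  have "Poly_Mapping.lookup (lin_ext basis x) s
      = (\<Sum>t\<in>Poly_Mapping.keys x. if t = s then Poly_Mapping.lookup x t else 0)"
    unfolding lin_ext_def lookup_sum
    by (intro sum.cong) (auto simp: basis_def lookup_single)
  also have "\<dots> = Poly_Mapping.lookup x s"
    by (simp add: in_keys_iff)
  finally show "Poly_Mapping.lookup (lin_ext basis x) s = Poly_Mapping.lookup x s" .
qed

lemma flinear_eq_lin_ext: "flinear L \<Longrightarrow> L x = lin_ext (\<lambda>s. L (basis s)) x"
  using flinear_push [of L basis x] by simp

lemma lin_ext_cong:
  "(\<And>s. s \<in> Poly_Mapping.keys x \<Longrightarrow> g s = h s) \<Longrightarrow> lin_ext g x = lin_ext h x"
  by (simp add: lin_ext_def)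

text \<open>A linear map is the linear extension of its values on the basis. Only the basis elements
  in the support of \<open>x\<close> have to be tested, so a restriction on the length or arity of
  \<open>x\<close> is available in the test.\<close>

lemma flinear_eqI:
  assumes "flinear L" "flinear K" "\<And>s. s \<in> Poly_Mapping.keys x \<Longrightarrow> L (basis s) = K (basis s)"
  shows "L x = K x"
  unfolding flinear_eq_lin_ext [OF assms(1), of x] flinear_eq_lin_ext [OF assms(2), of x]
  by (intro lin_ext_cong assms(3))

lemma lin_ext_in_subspace:
  assumes "fs.subspace N" "\<And>s. s \<in> Poly_Mapping.keys x \<Longrightarrow> g s \<in> N"
  shows "lin_ext g x \<in> N"
  unfolding lin_ext_def using assms by (intro fs.subspace_sum fs.subspace_scale) auto

lemma flinear_bilin_ext_left: "flinear (\<lambda>x. bilin_ext g x y)"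
  unfolding bilin_ext_def by (rule flinear_lin_ext)

lemma flinear_bilin_ext_right: "flinear (bilin_ext g x)"
  unfolding bilin_ext_def
  by (intro flinearI)
    (auto simp: flinear_add [OF flinear_lin_ext] flinear_scale [OF flinear_lin_ext]
      lin_ext_add_fun lin_ext_scale_fun)

lemma bilin_ext_basis [simp]: "bilin_ext g (basis s) (basis t) = g s t"
  by (simp add: bilin_ext_def)

lemma basis_in_free_on [simp]: "basis s \<in> free_on S \<longleftrightarrow> s \<in> S"
  by (simp add: free_on_def basis_def)

lemma subspace_free_on: "fs.subspace (free_on S)"
  unfolding fs.subspace_def free_on_def
  by (auto simp: in_keys_iff lookup_add) (metis add_0 in_keys_iff subsetD)

section \<open>Cosets and operations on quotients\<close>

lemma coset_eq_iff: "fs.subspace N \<Longrightarrow> coset N x = coset N y \<longleftrightarrow> x - y \<in> N"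
proof
  assume N: "fs.subspace N" and "coset N x = coset N y"
  then have "x \<in> coset N y"
    by (metis coset_def mem_Collect_eq diff_self fs.subspace_0)
  then show "x - y \<in> N"
    by (simp add: coset_def)
next
  assume N: "fs.subspace N" and xy: "x - y \<in> N"
  have "z - x \<in> N \<longleftrightarrow> z - y \<in> N" for z
    using fs.subspace_add [OF N, of "z - x" "x - y"] fs.subspace_diff [OF N, of "z - y" "x - y"] xy
    by auto
  then show "coset N x = coset N y"
    by (simp add: coset_def)
qed

lemma coset_self: "fs.subspace N \<Longrightarrow> x \<in> coset N x"
  by (simp add: coset_def fs.subspace_0)

lemma mem_coset_iff: "fs.subspace N \<Longrightarrow> y \<in> coset N x \<longleftrightarrow> coset N y = coset N x"
  by (simp add: coset_eq_iff) (simp add: coset_def)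

lemma coset_add_cong:
  assumes "fs.subspace N" "coset N x = coset N x'" "coset N y = coset N y'"
  shows "coset N (x + y) = coset N (x' + y')"
  using assms(2,3) fs.subspace_add [OF assms(1), of "x - x'" "y - y'"]
  by (simp add: coset_eq_iff [OF assms(1)] algebra_simps)

lemma coset_scale_cong:
  assumes "fs.subspace N" "coset N x = coset N x'"
  shows "coset N (fscale c x) = coset N (fscale c x')"
  using assms(2) fs.subspace_scale [OF assms(1), of "x - x'" c]
  by (simp add: coset_eq_iff [OF assms(1)] fs.scale_right_diff_distrib)

lemma coset_linear_cong:
  assumes "fs.subspace N" "fs.subspace N'" "flinear L" "\<And>z. z \<in> N \<Longrightarrow> L z \<in> N'"
    and "coset N x = coset N y"
  shows "coset N' (L x) = coset N' (L y)"
  using assms(4) [of "x - y"] assms(5) flinear_diff [OF assms(3), of x y]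
  by (simp add: coset_eq_iff [OF assms(1)] coset_eq_iff [OF assms(2)])

lemma coset_lin_ext_cong:
  assumes N: "fs.subspace N"
    and "\<And>s. s \<in> Poly_Mapping.keys x \<Longrightarrow> coset N (g s) = coset N (h s)"
  shows "coset N (lin_ext g x) = coset N (lin_ext h x)"
proof -
  have "lin_ext g x - lin_ext h x = lin_ext (\<lambda>s. g s - h s) x"
    by (simp add: lin_ext_def fs.scale_right_diff_distrib sum_subtractf)
  also have "\<dots> \<in> N"
    using assms by (intro lin_ext_in_subspace) (auto simp: coset_eq_iff)
  finally show ?thesis
    using N by (simp add: coset_eq_iff)
qed

text \<open>Operations on quotients are unions over all representatives; once the value is
  independent of the representative, the union collapses to a single coset.\<close>

lemma UN_coset_map:
  assumes "fs.subspace N" "\<And>x'. coset N x' = coset N x \<Longrightarrow> F x' = F x"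
  shows "(\<Union>x\<in>coset N x. F x) = F x"
proof -
  have "F x' = F x" if "x' \<in> coset N x" for x'
    using that mem_coset_iff [OF assms(1)] assms(2) by blast
  then show ?thesis
    using coset_self [OF assms(1), of x] by blast
qed

lemma qadd_coset:
  assumes "fs.subspace N"
  shows "qadd N (coset N x) (coset N y) = coset N (x + y)"
  unfolding qadd_def
proof -
  have "(\<Union>y'\<in>coset N y. coset N (x' + y')) = coset N (x' + y)" for x'
    by (rule UN_coset_map [OF assms]) (rule coset_add_cong [OF assms refl])
  then show "(\<Union>x'\<in>coset N x. \<Union>y'\<in>coset N y. coset N (x' + y')) = coset N (x + y)"
    by (simp, intro UN_coset_map [OF assms] coset_add_cong [OF assms _ refl])
qed

lemma qscale_coset:
  assumes "fs.subspace N"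
  shows "qscale N c (coset N x) = coset N (fscale c x)"
  unfolding qscale_def
  by (intro UN_coset_map [OF assms] coset_scale_cong [OF assms])


section \<open>Maps that are linear modulo a subspace\<close>

text \<open>A letter is a basis index of the free space, so the sum of two letters is unrelated to
  the sum of their basis elements until a quotient is taken; hence linearity in a letter can only be
  asked modulo \<open>N\<close>. Additivity and homogeneity are merged into one equation.\<close>

definition lin_mod :: "('k::field \<Rightarrow> 'a::ab_group_add \<Rightarrow> 'a) \<Rightarrow> ('x \<Rightarrow>\<^sub>0 'k) set
    \<Rightarrow> ('a \<Rightarrow> ('x \<Rightarrow>\<^sub>0 'k)) \<Rightarrow> bool" where
  "lin_mod sc N g \<longleftrightarrow>
     (\<forall>c a b. coset N (g (sc c a + b)) = coset N (fscale c (g a) + g b))"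

lemma lin_mod_zero [simp]: "lin_mod sc N (\<lambda>a. 0)"
  by (simp add: lin_mod_def)

lemma lin_mod_compose:
  assumes "lin_mod sc N g" "fs.subspace N" "fs.subspace N'" "flinear L" "\<And>z. z \<in> N \<Longrightarrow> L z \<in> N'"
  shows "lin_mod sc N' (\<lambda>a. L (g a))"
  unfolding lin_mod_def
proof (intro allI)
  fix c a b
  have "coset N' (L (g (sc c a + b))) = coset N' (L (fscale c (g a) + g b))"
    using assms(1) unfolding lin_mod_def
    by (intro coset_linear_cong [OF assms(2-5)]) auto
  then show "coset N' (L (g (sc c a + b))) = coset N' (fscale c (L (g a)) + L (g b))"
    by (simp add: flinear_add [OF assms(4)] flinear_scale [OF assms(4)])
qed

lemma lin_mod_lin_ext:
  assumes "fs.subspace N" "\<And>s. s \<in> Poly_Mapping.keys z \<Longrightarrow> lin_mod sc N (g s)"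
  shows "lin_mod sc N (\<lambda>a. lin_ext (\<lambda>s. g s a) z)"
  unfolding lin_mod_def
proof (intro allI)
  fix c a b
  have "coset N (lin_ext (\<lambda>s. g s (sc c a + b)) z)
      = coset N (lin_ext (\<lambda>s. fscale c (g s a) + g s b) z)"
    using assms by (intro coset_lin_ext_cong) (auto simp: lin_mod_def)
  then show "coset N (lin_ext (\<lambda>s. g s (sc c a + b)) z)
      = coset N (fscale c (lin_ext (\<lambda>s. g s a) z) + lin_ext (\<lambda>s. g s b) z)"
    by (simp add: lin_ext_add_fun lin_ext_scale_fun)
qed

section \<open>The multilinearity relations\<close>

lemma subspace_multilin: "fs.subspace (multilin sc)"
  unfolding multilin_def by (rule fs.subspace_span)

lemma lin_mod_basis:
  fixes sc :: "'k::field \<Rightarrow> 'a::ab_group_add \<Rightarrow> 'a"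
  shows "lin_mod sc (multilin sc) (\<lambda>a. basis (u @ [a] @ v))"
  unfolding lin_mod_def coset_eq_iff [OF subspace_multilin]
proof (intro allI)
  fix c a b
  let ?w = "\<lambda>a. basis (u @ [a] @ v) :: 'a list \<Rightarrow>\<^sub>0 'k"
  have "?w (sc c a + b) - ?w (sc c a) - ?w b \<in> multilin sc"
    unfolding multilin_def by (rule fs.span_base) blast
  moreover have "?w (sc c a) - fscale c (?w a) \<in> multilin sc"
    unfolding multilin_def by (rule fs.span_base) blast
  ultimately show "?w (sc c a + b) - (fscale c (?w a) + ?w b) \<in> multilin sc"
    using fs.subspace_add [OF subspace_multilin] by (fastforce simp: algebra_simps)
qed

text \<open>Universal property of the tensor algebra: a function of words that is linear modulo
  \<open>N\<close> in each letter factors through the quotient by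
  \<open>multilin sc\<close>.\<close>

lemma lin_ext_multilin:
  assumes sc: "vector_space sc" and N: "fs.subspace N"
    and g: "\<And>u v. lin_mod sc N (\<lambda>a. g (u @ [a] @ v))"
    and x: "x \<in> multilin sc"
  shows "lin_ext g x \<in> N"
proof -
  interpret A: vector_space sc by (rule sc)
  note lin = flinear_lin_ext [of g]
  let ?g = "\<lambda>u a v. g (u @ [a] @ v)"
  have add: "?g u (a + b) v - ?g u a v - ?g u b v \<in> N" for u a b v
  proof -
    have "coset N (?g u (sc 1 a + b) v) = coset N (fscale 1 (?g u a v) + ?g u b v)"
      using g unfolding lin_mod_def by blast
    then show ?thesis
      using N by (simp add: coset_eq_iff diff_diff_eq)
  qed
  \<comment> \<open>Additivity at two zero letters gives the negative of this value.\<close>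
  have zero: "?g u 0 v \<in> N" for u v
    using add [of u 0 0 v] fs.subspace_neg [OF N, of "- ?g u 0 v"] by simp
  have scale: "?g u (sc c a) v - fscale c (?g u a v) \<in> N" for u c a v
  proof -
    have "coset N (?g u (sc c a + 0) v) = coset N (fscale c (?g u a v) + ?g u 0 v)"
      using g unfolding lin_mod_def by blast
    then show ?thesis
      using N zero [of u v] fs.subspace_add [OF N, of _ "?g u 0 v"]
      by (force simp: coset_eq_iff algebra_simps)
  qed
  have "fs.subspace {x. lin_ext g x \<in> N}"
    unfolding fs.subspace_def
    using N by (auto simp: flinear_add [OF lin] flinear_scale [OF lin] fs.subspace_def)
  moreover have "lin_ext g y \<in> N"
    if "y \<in> {basis (u @ [a + b] @ v) - basis (u @ [a] @ v) - basis (u @ [b] @ v) |u a b v. True} \<union>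
      {basis (u @ [sc c a] @ v) - fscale c (basis (u @ [a] @ v)) |u c a v. True}" for y
    using that add scale by (auto simp: flinear_diff [OF lin] flinear_scale [OF lin])
  ultimately show ?thesis
    by (rule fs.span_induct [OF x [unfolded multilin_def]])
qed

lemma lin_ext_multilin_cong:
  assumes sc: "vector_space sc" and N: "fs.subspace N"
    and g: "\<And>u v. lin_mod sc N (\<lambda>a. g (u @ [a] @ v))"
    and xy: "coset (multilin sc) x = coset (multilin sc) y"
  shows "coset N (lin_ext g x) = coset N (lin_ext g y)"
  using lin_ext_multilin [OF sc N g]
  by (rule coset_linear_cong [OF subspace_multilin N flinear_lin_ext _ xy])

section \<open>Concatenation of words\<close>

lemma free_cat_basis [simp]: "free_cat (basis u) (basis v) = basis (u @ v)"
  by (simp add: free_cat_def)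

lemma flinear_free_cat_left: "flinear L \<Longrightarrow> flinear (\<lambda>x. free_cat (L x) y)"
  unfolding free_cat_def by (rule flinear_compose [OF flinear_bilin_ext_left])

lemma flinear_free_cat_right: "flinear L \<Longrightarrow> flinear (\<lambda>x. free_cat y (L x))"
  unfolding free_cat_def by (rule flinear_compose [OF flinear_bilin_ext_right])

lemmas flinear_free_cat = flinear_free_cat_left flinear_free_cat_right flinear_id

lemma free_cat_Nil_left [simp]: "free_cat (basis []) y = y"
  by (rule flinear_eqI [of "free_cat (basis [])" "\<lambda>y. y"]) (auto intro!: flinear_free_cat)

lemma free_cat_Nil_right [simp]: "free_cat x (basis []) = x"
  by (rule flinear_eqI [of "\<lambda>x. free_cat x (basis [])" "\<lambda>x. x"]) (auto intro!: flinear_free_cat)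

lemma free_cat_zero [simp]: "free_cat 0 y = 0" "free_cat x 0 = 0"
  by (rule flinear_zero [of "\<lambda>x. free_cat x y"] flinear_zero [of "free_cat x"],
      intro flinear_free_cat)+

lemma free_cat_assoc: "free_cat (free_cat x y) z = free_cat x (free_cat y z)"
proof -
  have 1: "free_cat (free_cat (basis u) (basis v)) z = free_cat (basis u) (free_cat (basis v) z)" for u v
    by (rule flinear_eqI [of "\<lambda>z. free_cat (free_cat (basis u) (basis v)) z"])
      (auto intro!: flinear_free_cat)
  have 2: "free_cat (free_cat (basis u) y) z = free_cat (basis u) (free_cat y z)" for u
    by (rule flinear_eqI [of "\<lambda>y. free_cat (free_cat (basis u) y) z"])
      (intro flinear_free_cat 1)+
  show ?thesis
    by (rule flinear_eqI [of "\<lambda>x. free_cat (free_cat x y) z"])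
      (intro flinear_free_cat 2)+
qed

lemma free_cat_in_free_on:
  assumes "x \<in> free_on {w. length w = m}" "y \<in> free_on {w. length w = n}"
  shows "free_cat x y \<in> free_on {w. length w = m + n}"
  unfolding free_cat_def bilin_ext_def
  using assms by (intro lin_ext_in_subspace subspace_free_on) (auto simp: free_on_def basis_def)

text \<open>Expanding the other factor into words reduces this to concatenation with a fixed word,
  which merely lengthens the context of the varying letter.\<close>

lemma free_cat_multilin:
  assumes sc: "vector_space sc"
  shows free_cat_multilin_left: "x \<in> multilin sc \<Longrightarrow> free_cat x y \<in> multilin sc"
    and free_cat_multilin_right: "y \<in> multilin sc \<Longrightarrow> free_cat x y \<in> multilin sc"
proof -
  assume x: "x \<in> multilin sc"
  show "free_cat x y \<in> multilin sc"
    unfolding flinear_eq_lin_ext [OF flinear_free_cat_right [OF flinear_id], of x y]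
  proof (rule lin_ext_in_subspace [OF subspace_multilin])
    fix v
    show "free_cat x (basis v) \<in> multilin sc"
      unfolding flinear_eq_lin_ext [OF flinear_free_cat_left [OF flinear_id], of x]
      using lin_mod_basis [of sc _ "_ @ v"] by (intro lin_ext_multilin [OF sc subspace_multilin _ x]) auto
  qed
next
  assume y: "y \<in> multilin sc"
  show "free_cat x y \<in> multilin sc"
    unfolding flinear_eq_lin_ext [OF flinear_free_cat_left [OF flinear_id], of x y]
  proof (rule lin_ext_in_subspace [OF subspace_multilin])
    fix u
    show "free_cat (basis u) y \<in> multilin sc"
      unfolding flinear_eq_lin_ext [OF flinear_free_cat_right [OF flinear_id], of _ y]
      using lin_mod_basis [of sc "u @ _"] by (intro lin_ext_multilin [OF sc subspace_multilin _ y]) auto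
  qed
qed

section \<open>Sums over two-letter tensors\<close>

text \<open>Replaces the symbolic sum: if \<open>z\<close> represents \<Phi>(a \<otimes> b), the
  value is the sum of \<open>h\<close> at the pairs (a' \<rightarrow> b', a'' \<triangleright> b'').
  The default 0 on words of other lengths keeps the map linear on the whole free space.\<close>

definition on_pairs :: "('a \<Rightarrow> 'a \<Rightarrow> ('x \<Rightarrow>\<^sub>0 'k)) \<Rightarrow> ('a list \<Rightarrow>\<^sub>0 'k::field) \<Rightarrow> ('x \<Rightarrow>\<^sub>0 'k)" where
  "on_pairs h = lin_ext (\<lambda>w. if length w = 2 then h (w ! 0) (w ! 1) else 0)"

definition bilin_mod :: "('k::field \<Rightarrow> 'a::ab_group_add \<Rightarrow> 'a) \<Rightarrow> ('x \<Rightarrow>\<^sub>0 'k) set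
    \<Rightarrow> ('a \<Rightarrow> 'a \<Rightarrow> ('x \<Rightarrow>\<^sub>0 'k)) \<Rightarrow> bool" where
  "bilin_mod sc N h \<longleftrightarrow> (\<forall>a. lin_mod sc N (h a)) \<and> (\<forall>b. lin_mod sc N (\<lambda>a. h a b))"

lemma flinear_on_pairs: "flinear (on_pairs h)"
  unfolding on_pairs_def by (rule flinear_lin_ext)

lemma on_pairs_basis [simp]: "on_pairs h (basis [a, b]) = h a b"
  by (simp add: on_pairs_def)

lemma on_pairs_push:
  assumes "flinear L"
  shows "L (on_pairs h z) = on_pairs (\<lambda>a b. L (h a b)) z"
  unfolding on_pairs_def flinear_push [OF assms]
  by (rule lin_ext_cong) (simp add: flinear_zero [OF assms])

lemma on_pairs_cong:
  assumes "fs.subspace N" "\<And>a b. coset N (h a b) = coset N (h' a b)"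
  shows "coset N (on_pairs h z) = coset N (on_pairs h' z)"
  unfolding on_pairs_def using assms by (intro coset_lin_ext_cong) auto

text \<open>Turns an element of degree two into an explicit sum over pairs, so that any linear map
  can then be pushed inside with \<open>on_pairs_push\<close>.\<close>

lemma on_pairs_basis_id:
  assumes "z \<in> free_on {w. length w = 2}"
  shows "on_pairs (\<lambda>a b. basis [a, b]) z = z"
proof -
  have "on_pairs (\<lambda>a b. basis [a, b]) z = lin_ext basis z"
    unfolding on_pairs_def
  proof (rule lin_ext_cong)
    fix w
    assume "w \<in> Poly_Mapping.keys z"
    then have "length w = 2"
      using assms by (auto simp: free_on_def)
    then show "(if length w = 2 then basis [w ! 0, w ! 1] else 0) = basis w"
      by (auto simp: numeral_2_eq_2 length_Suc_conv)
  qed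
  then show ?thesis
    by simp
qed

lemma on_pairs_multilin:
  fixes sc :: "'k::field \<Rightarrow> 'a::ab_group_add \<Rightarrow> 'a"
  assumes "vector_space sc" "fs.subspace N" "bilin_mod sc N h" "z \<in> multilin sc"
  shows "on_pairs h z \<in> N"
  unfolding on_pairs_def
proof (rule lin_ext_multilin [OF assms(1,2) _ assms(4)])
  fix u v :: "'a list"
  \<comment> \<open>Only a context of exactly one letter gives a two-letter word; in every other
    case the function is constantly 0.\<close>
  consider p where "u = []" "v = [p]" | p where "u = [p]" "v = []" | "length (u @ v) \<noteq> 1"
    by (cases u; cases v) auto
  then show "lin_mod sc N (\<lambda>a. if length (u @ [a] @ v) = 2
      then h ((u @ [a] @ v) ! 0) ((u @ [a] @ v) ! 1) else 0)"
    using assms(3) by cases (auto simp: bilin_mod_def)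
qed

lemma lin_mod_on_pairs:
  assumes "fs.subspace N" "\<And>p q. lin_mod sc N (g p q)"
  shows "lin_mod sc N (\<lambda>a. on_pairs (\<lambda>p q. g p q a) z)"
  unfolding on_pairs_def
proof (rule lin_mod_lin_ext [OF assms(1)])
  fix w
  show "lin_mod sc N (\<lambda>a. if length w = 2 then g (w ! 0) (w ! 1) a else 0)"
    using assms(2) by (cases "length w = 2") auto
qed

lemma flinear_on_pairs_fun:
  assumes "\<And>p q. flinear (h p q)"
  shows "flinear (\<lambda>x. on_pairs (\<lambda>p q. h p q x) z)"
proof -
  have "on_pairs (\<lambda>p q. h p q x + h p q y) z = on_pairs (\<lambda>p q. h p q x) z + on_pairs (\<lambda>p q. h p q y) z" for x y
    unfolding on_pairs_def lin_ext_add_fun [symmetric] by (rule lin_ext_cong) simp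
  moreover have "on_pairs (\<lambda>p q. fscale c (h p q x)) z = fscale c (on_pairs (\<lambda>p q. h p q x) z)" for c x
    unfolding on_pairs_def lin_ext_scale_fun [symmetric] by (rule lin_ext_cong) simp
  ultimately show ?thesis
    by (intro flinearI) (simp_all add: flinear_add [OF assms] flinear_scale [OF assms])
qed

lemma on_pairs_in_subspace:
  assumes "fs.subspace N" "\<And>p q. h p q \<in> N"
  shows "on_pairs h z \<in> N"
  unfolding on_pairs_def using assms by (intro lin_ext_in_subspace) (auto simp: fs.subspace_0)

lemma lin_mod_free_cat_left:
  assumes sc: "vector_space sc" and "lin_mod sc (multilin sc) L"
  shows "lin_mod sc (multilin sc) (\<lambda>a. free_cat (L a) y)"
  by (rule lin_mod_compose [OF assms(2) subspace_multilin subspace_multilin])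
    (intro flinear_free_cat free_cat_multilin_left [OF sc], assumption?)+

lemma lin_mod_free_cat_right:
  assumes sc: "vector_space sc" and "lin_mod sc (multilin sc) L"
  shows "lin_mod sc (multilin sc) (\<lambda>a. free_cat y (L a))"
  by (rule lin_mod_compose [OF assms(2) subspace_multilin subspace_multilin])
    (intro flinear_free_cat free_cat_multilin_right [OF sc], assumption?)+

section \<open>Applying a map to two adjacent letters\<close>

text \<open>The counterpart of \<open>at_slot\<close> on representatives: a fixed \<open>g\<close>
  replaces the arbitrary choice of an element of the image.\<close>

definition slot :: "nat \<Rightarrow> ('a \<Rightarrow> 'a \<Rightarrow> ('a list \<Rightarrow>\<^sub>0 'k)) \<Rightarrow> ('a list \<Rightarrow>\<^sub>0 'k::field) \<Rightarrow> ('a list \<Rightarrow>\<^sub>0 'k)" where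
  "slot j g = lin_ext (\<lambda>w. if j + 2 \<le> length w
     then free_cat (basis (take j w)) (free_cat (g (w ! j) (w ! (j + 1))) (basis (drop (j + 2) w)))
     else 0)"

lemma flinear_slot: "flinear L \<Longrightarrow> flinear (\<lambda>x. slot j g (L x))"
  unfolding slot_def by (rule flinear_compose [OF flinear_lin_ext])

lemma slot_basis:
  "length u = j \<Longrightarrow> slot j g (basis (u @ [a, b] @ v)) = free_cat (basis u) (free_cat (g a b) (basis v))"
  by (simp add: slot_def nth_append)

lemma split_two:
  assumes "n + 2 \<le> length v"
  shows "v = take n v @ [v ! n, v ! (n + 1)] @ drop (n + 2) v"
  using assms id_take_nth_drop [of n v] Cons_nth_drop_Suc [of "n + 1" v] by simp

text \<open>A varying letter lies before the pair, in the pair or after it. In the pair, bilinearity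
  of \<open>g\<close> is used; elsewhere the letter is only carried along by concatenation.\<close>

lemma slot_multilin:
  fixes sc :: "'k::field \<Rightarrow> 'a::ab_group_add \<Rightarrow> 'a"
  assumes sc: "vector_space sc" and g: "bilin_mod sc (multilin sc) g" and x: "x \<in> multilin sc"
  shows "slot j g x \<in> multilin sc"
  unfolding slot_def
proof (rule lin_ext_multilin [OF sc subspace_multilin _ x])
  fix u v :: "'a list"
  let ?M = "multilin sc"
  define F where "F w = (if j + 2 \<le> length w
     then free_cat (basis (take j w)) (free_cat (g (w ! j) (w ! (j + 1))) (basis (drop (j + 2) w)))
     else 0)" for w
  have F: "F (u @ [a, b] @ v) = free_cat (basis u) (free_cat (g a b) (basis v))" if "length u = j" for u a b v
    using slot_basis [OF that, of g a b v] by (simp add: slot_def F_def)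
  note left = lin_mod_free_cat_left [OF sc] and right = lin_mod_free_cat_right [OF sc]
  \<comment> \<open>In this order: the word is too short, the letter lies left of the pair, is its
    first member, is its second member, or lies right of it.\<close>
  consider "length u + length v < j + 1" | "length u < j" "j + 1 \<le> length u + length v"
    | "length u = j" "v \<noteq> []" | "length u = j + 1" | "j + 2 \<le> length u"
    by fastforce
  then have "lin_mod sc ?M (\<lambda>a. F (u @ [a] @ v))"
  proof cases
    case 1
    then show ?thesis by (simp add: F_def)
  next
    case 2
    \<comment> \<open>The pair lies inside \<open>v\<close>, and its first letter has position
      \<open>n\<close> there.\<close>
    define n where "n = j - length u - 1"
    have "n + 2 \<le> length v" and n: "length (u @ [a] @ take n v) = j" for a
      using 2 by (auto simp: n_def)
    then have v: "v = take n v @ [v ! n, v ! (n + 1)] @ drop (n + 2) v"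
      by (intro split_two)
    have "F (u @ [a] @ v) = free_cat (basis (u @ [a] @ take n v))
        (free_cat (g (v ! n) (v ! (n + 1))) (basis (drop (n + 2) v)))" for a
      using F [OF n, of a "v ! n" "v ! (n + 1)" "drop (n + 2) v"] v by simp
    then show ?thesis
      using left [OF lin_mod_basis] by simp
  next
    case 3
    then obtain b v' where "v = b # v'" by (cases v) auto
    then have "F (u @ [a] @ v) = free_cat (basis u) (free_cat (g a b) (basis v'))" for a
      using F [OF 3(1), of a b v'] by simp
    moreover have "lin_mod sc ?M (\<lambda>a. g a b)"
      using g by (simp add: bilin_mod_def)
    ultimately show ?thesis
      using right [OF left] by simp
  next
    case 4
    then obtain u' b where u: "u = u' @ [b]" by (cases u rule: rev_cases) auto
    then have "length u' = j" using 4 by simp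
    then have "F (u @ [a] @ v) = free_cat (basis u') (free_cat (g b a) (basis v))" for a
      using F [of u' b a v] u by simp
    moreover have "lin_mod sc ?M (g b)"
      using g by (simp add: bilin_mod_def)
    ultimately show ?thesis
      using right [OF left] by simp
  next
    case 5
    then have u: "u = take j u @ [u ! j, u ! (j + 1)] @ drop (j + 2) u"
      by (intro split_two)
    have "F (u @ [a] @ v) = free_cat (basis (take j u))
        (free_cat (g (u ! j) (u ! (j + 1))) (basis (drop (j + 2) u @ [a] @ v)))" for a
      using F [of "take j u" "u ! j" "u ! (j + 1)" "drop (j + 2) u @ [a] @ v"] u 5
      by (metis append.assoc length_take add_leD1 min.absorb2)
    then show ?thesis
      using right [OF right [OF lin_mod_basis]] by simp
  qed
  then show "lin_mod sc ?M (\<lambda>a. if j + 2 \<le> length (u @ [a] @ v)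
     then free_cat (basis (take j (u @ [a] @ v))) (free_cat
       (g ((u @ [a] @ v) ! j) ((u @ [a] @ v) ! (j + 1))) (basis (drop (j + 2) (u @ [a] @ v)))) else 0)"
    unfolding F_def .
qed

lemma slot_coset_cong:
  assumes "vector_space sc" "bilin_mod sc (multilin sc) g" "coset (multilin sc) x = coset (multilin sc) y"
  shows "coset (multilin sc) (slot j g x) = coset (multilin sc) (slot j g y)"
  by (rule coset_linear_cong [OF subspace_multilin subspace_multilin flinear_slot [OF flinear_id] _ assms(3)])
    (rule slot_multilin [OF assms(1,2)])

lemma free_cat_coset_cong:
  assumes sc: "vector_space sc"
    and x: "coset (multilin sc) x = coset (multilin sc) x'"
    and y: "coset (multilin sc) y = coset (multilin sc) y'"
  shows "coset (multilin sc) (free_cat x y) = coset (multilin sc) (free_cat x' y')"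
proof -
  have "coset (multilin sc) (free_cat x y) = coset (multilin sc) (free_cat x' y)"
    by (rule coset_linear_cong [OF subspace_multilin subspace_multilin _ _ x])
      (intro flinear_free_cat free_cat_multilin_left [OF sc], assumption?)+
  also have "\<dots> = coset (multilin sc) (free_cat x' y')"
    by (rule coset_linear_cong [OF subspace_multilin subspace_multilin _ _ y])
      (intro flinear_free_cat free_cat_multilin_right [OF sc], assumption?)+
  finally show ?thesis .
qed

section \<open>Descent of the tensor operations to cosets\<close>

lemma tcat_coset:
  assumes sc: "vector_space sc"
  shows "tcat sc (coset (multilin sc) x) (coset (multilin sc) y) = coset (multilin sc) (free_cat x y)"
  unfolding tcat_def
proof -
  have "(\<Union>y'\<in>coset (multilin sc) y. coset (multilin sc) (free_cat x' y')) = coset (multilin sc) (free_cat x' y)" for x'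
    by (rule UN_coset_map [OF subspace_multilin]) (rule free_cat_coset_cong [OF sc refl])
  then show "(\<Union>x'\<in>coset (multilin sc) x. \<Union>y'\<in>coset (multilin sc) y.
      coset (multilin sc) (free_cat x' y')) = coset (multilin sc) (free_cat x y)"
    by (simp, intro UN_coset_map [OF subspace_multilin] free_cat_coset_cong [OF sc _ refl])
qed

text \<open>The element picked by \<open>SOME\<close> differs from \<open>g a b\<close> by an
  element of \<open>multilin sc\<close>, and concatenation does not see this difference.\<close>

lemma at_slot_coset:
  assumes sc: "vector_space sc" and g: "bilin_mod sc (multilin sc) g"
    and f: "\<And>a b. f (word sc [a, b]) = coset (multilin sc) (g a b)"
  shows "at_slot sc j f (coset (multilin sc) x) = coset (multilin sc) (slot j g x)"
proof -
  let ?M = "multilin sc"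
  define g' where "g' a b = (SOME y. y \<in> f (word sc [a, b]))" for a b
  have "g' a b \<in> coset ?M (g a b)" for a b
    unfolding g'_def f by (rule someI) (rule coset_self [OF subspace_multilin])
  then have g': "coset ?M (g' a b) = coset ?M (g a b)" for a b
    by (simp add: mem_coset_iff [OF subspace_multilin])
  have "coset ?M (slot j g' y) = coset ?M (slot j g y)" for y
    unfolding slot_def
    by (rule coset_lin_ext_cong [OF subspace_multilin])
      (simp add: free_cat_coset_cong [OF sc refl free_cat_coset_cong [OF sc g' refl]])
  moreover have "at_slot sc j f (coset ?M x) = (\<Union>y\<in>coset ?M x. coset ?M (slot j g' y))"
    unfolding at_slot_def slot_def g'_def ..
  ultimately have "at_slot sc j f (coset ?M x) = (\<Union>y\<in>coset ?M x. coset ?M (slot j g y))"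
    by simp
  also have "\<dots> = coset ?M (slot j g x)"
    by (rule UN_coset_map [OF subspace_multilin]) (rule slot_coset_cong [OF sc g])
  finally show ?thesis .
qed

lemma tflip_word:
  fixes sc :: "'k::field \<Rightarrow> 'a::ab_group_add \<Rightarrow> 'a"
  assumes sc: "vector_space sc"
  shows "tflip sc (word sc w) = word sc (rev w)"
proof -
  let ?M = "multilin sc"
  have "tflip sc (coset ?M x) = coset ?M (lin_ext (\<lambda>w. basis (rev w)) x)" for x
    unfolding tflip_def
  proof (rule UN_coset_map [OF subspace_multilin], rule lin_ext_multilin_cong [OF sc subspace_multilin])
    fix u v :: "'a list"
    show "lin_mod sc ?M (\<lambda>a. basis (rev (u @ [a] @ v)))"
      using lin_mod_basis [of sc "rev v" "rev u"] by simp
  qed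
  then show ?thesis
    by (simp add: word_def)
qed

lemma bilin_mod_swap: "bilin_mod sc (multilin sc) (\<lambda>a b. basis [b, a])"
  unfolding bilin_mod_def
proof (intro conjI allI)
  fix a
  show "lin_mod sc (multilin sc) (\<lambda>b. basis [b, a])" "lin_mod sc (multilin sc) (\<lambda>b. basis [a, b])"
    using lin_mod_basis [of sc "[]" "[a]"] lin_mod_basis [of sc "[a]" "[]"] by simp_all
qed

section \<open>Representatives of the structure map\<close>

text \<open>The representatives of \<Phi>(a \<otimes> b) are chosen independently for each pair of
  letters, so \<open>\<phi>\<close> is bilinear only modulo \<open>multilin sc\<close>.\<close>

locale lEAS_rep =
  fixes sc :: "'k::field \<Rightarrow> 'a::ab_group_add \<Rightarrow> 'a"
    and \<Phi> :: "('a, 'k) tensor \<Rightarrow> ('a, 'k) tensor"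
    and \<phi> :: "'a \<Rightarrow> 'a \<Rightarrow> ('a list \<Rightarrow>\<^sub>0 'k)"
  assumes sc: "vector_space sc"
    and \<Phi>_word: "\<Phi> (word sc [a, b]) = coset (multilin sc) (\<phi> a b)"
    and \<phi>_free_on: "\<phi> a b \<in> free_on {w. length w = 2}"
    and \<phi>_bilin: "bilin_mod sc (multilin sc) \<phi>"
    and \<phi>_slots: "x \<in> free_on {w. length w = 3} \<Longrightarrow>
      coset (multilin sc) (slot 1 \<phi> (slot 0 \<phi> (slot 1 \<phi> x))) =
      coset (multilin sc) (slot 0 \<phi> (slot 1 (\<lambda>a b. basis [b, a]) (slot 0 \<phi> x)))"

lemma lEAS_imp_rep:
  fixes sc :: "'k::field \<Rightarrow> 'a::ab_group_add \<Rightarrow> 'a"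
  assumes "lEAS sc \<Phi>"
  shows "\<exists>\<phi>. lEAS_rep sc \<Phi> \<phi>"
proof -
  let ?M = "multilin sc"
  have sc: "vector_space sc"
    and lin: "qlinear ?M (tensor_power sc 2) ?M (tensor_power sc 2) \<Phi>"
    and slots: "\<And>X. X \<in> tensor_power sc 3 \<Longrightarrow>
        at_slot sc 1 \<Phi> (at_slot sc 0 \<Phi> (at_slot sc 1 \<Phi> X)) =
        at_slot sc 0 \<Phi> (at_slot sc 1 (tflip sc) (at_slot sc 0 \<Phi> X))"
    using assms by (auto simp: lEAS_def)
  have word2: "word sc [a, b] \<in> tensor_power sc 2" for a b
    unfolding word_def tensor_power_def by (intro imageI) simp
  have "\<Phi> (word sc [a, b]) \<in> tensor_power sc 2" for a b
    using lin word2 by (auto simp: qlinear_def)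
  then have "\<exists>y. y \<in> free_on {w. length w = 2} \<and> \<Phi> (word sc [a, b]) = coset ?M y" for a b
    unfolding tensor_power_def image_iff by blast
  then obtain \<phi> where \<phi>: "\<And>a b. \<phi> a b \<in> free_on {w. length w = 2}"
    "\<And>a b. \<Phi> (word sc [a, b]) = coset ?M (\<phi> a b)"
    by metis
  \<comment> \<open>\<open>qlinear\<close> speaks only of members of the tensor power, so the scaled
    word has to be placed there before additivity can be applied to it.\<close>
  have scale2: "qscale ?M c (word sc [a, b]) \<in> tensor_power sc 2" for c a b
    unfolding word_def qscale_coset [OF subspace_multilin] tensor_power_def
    by (intro imageI fs.subspace_scale subspace_free_on) simp
  \<comment> \<open>A linear relation between two-letter words in the quotient passes through \<Phi>
    to their representatives. Bilinearity of \<open>\<phi>\<close> is the special case of relations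
    in one of the two letters.\<close>
  have comb: "coset ?M (\<phi> a'' b'') = coset ?M (fscale c (\<phi> a b) + \<phi> a' b')"
    if "word sc [a'', b''] = qadd ?M (qscale ?M c (word sc [a, b])) (word sc [a', b'])"
    for c a b a' b' a'' b''
  proof -
    have "coset ?M (\<phi> a'' b'') = qadd ?M (qscale ?M c (\<Phi> (word sc [a, b]))) (\<Phi> (word sc [a', b']))"
      using lin word2 scale2 unfolding qlinear_def \<phi>(2) [symmetric] that by simp
    then show ?thesis
      by (simp add: \<phi> qadd_coset qscale_coset subspace_multilin)
  qed
  have bilin: "bilin_mod sc ?M \<phi>"
    unfolding bilin_mod_def lin_mod_def
  proof (intro conjI allI)
    fix p c a b
    have "coset ?M (basis [p, sc c a + b]) = coset ?M (fscale c (basis [p, a]) + basis [p, b])"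
      using lin_mod_basis [of sc "[p]" "[]"] by (simp add: lin_mod_def)
    then show "coset ?M (\<phi> p (sc c a + b)) = coset ?M (fscale c (\<phi> p a) + \<phi> p b)"
      by (intro comb) (simp add: word_def qadd_coset qscale_coset subspace_multilin)
    have "coset ?M (basis [sc c a + b, p]) = coset ?M (fscale c (basis [a, p]) + basis [b, p])"
      using lin_mod_basis [of sc "[]" "[p]"] by (simp add: lin_mod_def)
    then show "coset ?M (\<phi> (sc c a + b) p) = coset ?M (fscale c (\<phi> a p) + \<phi> b p)"
      by (intro comb) (simp add: word_def qadd_coset qscale_coset subspace_multilin)
  qed
  have flip: "tflip sc (word sc [a, b]) = coset ?M (basis [b, a])" for a b
    by (simp add: tflip_word [OF sc]) (simp add: word_def)
  have "coset ?M (slot 1 \<phi> (slot 0 \<phi> (slot 1 \<phi> x))) =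
      coset ?M (slot 0 \<phi> (slot 1 (\<lambda>a b. basis [b, a]) (slot 0 \<phi> x)))"
    if "x \<in> free_on {w. length w = 3}" for x
    using slots [of "coset ?M x"] that
    by (simp add: tensor_power_def at_slot_coset [OF sc bilin \<phi>(2)] at_slot_coset [OF sc bilin_mod_swap flip])
  then have "lEAS_rep sc \<Phi> \<phi>"
    using sc \<phi> bilin by (intro lEAS_rep.intro)
  then show ?thesis
    by blast
qed

lemma coset_flinear_eqI:
  assumes "fs.subspace N" "flinear L" "flinear K"
    and "\<And>s. s \<in> Poly_Mapping.keys x \<Longrightarrow> coset N (L (basis s)) = coset N (K (basis s))"
  shows "coset N (L x) = coset N (K x)"
  unfolding flinear_eq_lin_ext [OF assms(2), of x] flinear_eq_lin_ext [OF assms(3), of x]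
  using assms(1,4) by (rule coset_lin_ext_cong)

lemma flinear_lin_ext_compose: "flinear L \<Longrightarrow> flinear (\<lambda>x. lin_ext g (L x))"
  by (rule flinear_compose [OF flinear_lin_ext])

lemma slot_0_basis:
  assumes "g a b \<in> free_on {w. length w = 2}"
  shows "slot 0 g (basis [a, b, c]) = on_pairs (\<lambda>p q. basis [p, q, c]) (g a b)"
proof -
  have "slot 0 g (basis [a, b, c]) = free_cat (on_pairs (\<lambda>p q. basis [p, q]) (g a b)) (basis [c])"
    using slot_basis [of "[]" 0 g a b "[c]"] by (simp add: on_pairs_basis_id [OF assms])
  then show ?thesis
    by (simp add: on_pairs_push [of "\<lambda>x. free_cat x (basis [c])"] flinear_free_cat)
qed

lemma slot_1_basis:
  assumes "g b c \<in> free_on {w. length w = 2}"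
  shows "slot 1 g (basis [a, b, c]) = on_pairs (\<lambda>p q. basis [a, p, q]) (g b c)"
proof -
  have "slot 1 g (basis [a, b, c]) = free_cat (basis [a]) (on_pairs (\<lambda>p q. basis [p, q]) (g b c))"
    using slot_basis [of "[a]" 1 g b c "[]"] by (simp add: on_pairs_basis_id [OF assms])
  then show ?thesis
    by (simp add: on_pairs_push [of "free_cat (basis [a])"] flinear_free_cat)
qed

section \<open>The action of a letter on a word\<close>

context lEAS_rep
begin

abbreviation M :: "('a list \<Rightarrow>\<^sub>0 'k) set" where
  "M \<equiv> multilin sc"

lemmas lin_mod_cat = lin_mod_free_cat_left [OF sc] lin_mod_free_cat_right [OF sc]

text \<open>\<open>act v a\<close> is the bracket of the proposition, applied to the word \<open>a v\<close>.\<close>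

primrec act :: "'a list \<Rightarrow> 'a \<Rightarrow> ('a list \<Rightarrow>\<^sub>0 'k)" where
  "act [] a = basis [a]"
| "act (b # v) a = on_pairs (\<lambda>p q. free_cat (basis [p]) (act v q)) (\<phi> a b)"

definition acts :: "'a \<Rightarrow> ('a list \<Rightarrow>\<^sub>0 'k) \<Rightarrow> ('a list \<Rightarrow>\<^sub>0 'k)" where
  "acts a = lin_ext (\<lambda>v. act v a)"

lemma flinear_acts: "flinear L \<Longrightarrow> flinear (\<lambda>x. acts a (L x))"
  unfolding acts_def by (rule flinear_lin_ext_compose)

lemma acts_basis [simp]: "acts a (basis v) = act v a"
  by (simp add: acts_def)

lemma act_free_on: "act v a \<in> free_on {w. length w = Suc (length v)}"
proof (induction v arbitrary: a)
  case (Cons b v)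
  have "free_cat (basis [p]) (act v q) \<in> free_on {w. length w = 1 + Suc (length v)}" for p q
    by (rule free_cat_in_free_on) (use Cons in auto)
  then show ?case
    by (simp add: on_pairs_in_subspace [OF subspace_free_on])
qed simp

lemma acts_free_on:
  assumes "x \<in> free_on {w. length w = n}"
  shows "acts a x \<in> free_on {w. length w = Suc n}"
  unfolding acts_def
proof (rule lin_ext_in_subspace [OF subspace_free_on])
  fix v
  assume "v \<in> Poly_Mapping.keys x"
  then have "length v = n"
    using assms by (auto simp: free_on_def)
  then show "act v a \<in> free_on {w. length w = Suc n}"
    using act_free_on [of v a] by simp
qed

lemma lin_mod_\<phi>:
  assumes "bilin_mod sc M h"
  shows "lin_mod sc M (\<lambda>a. on_pairs h (\<phi> a b))" "lin_mod sc M (\<lambda>b. on_pairs h (\<phi> a b))"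
  using \<phi>_bilin unfolding bilin_mod_def
  by (auto intro: lin_mod_compose [OF _ subspace_multilin subspace_multilin flinear_on_pairs
        on_pairs_multilin [OF sc subspace_multilin assms]])

lemma lin_mod_act: "lin_mod sc M (act v)"
proof (induction v)
  case Nil
  then show ?case
    using lin_mod_basis [of sc "[]" "[]"] by (simp add: fun_eq_iff lin_mod_def)
next
  case (Cons b v)
  have "lin_mod sc M (\<lambda>p. free_cat (basis [p]) (act v q))" for q
    using lin_mod_basis [of sc "[]" "[]"] by (intro lin_mod_cat) simp
  then have "bilin_mod sc M (\<lambda>p q. free_cat (basis [p]) (act v q))"
    using Cons lin_mod_cat(2) by (auto simp: bilin_mod_def)
  from lin_mod_\<phi>(1) [OF this] show ?case
    by (simp add: lin_mod_def)
qed

lemma bilin_mod_cat_act: "bilin_mod sc M (\<lambda>p q. free_cat (act v p) (act w q))"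
  unfolding bilin_mod_def by (auto intro!: lin_mod_cat lin_mod_act)

text \<open>The letters of \<open>u\<close> are met before \<open>x\<close>. After them,
  \<open>x\<close> enters as the second argument of \<open>\<phi>\<close>, which is linear modulo
  \<open>M\<close>.\<close>

lemma lin_mod_act_word: "lin_mod sc M (\<lambda>x. act (u @ [x] @ v) a)"
proof (induction u arbitrary: a)
  case Nil
  then show ?case
    using lin_mod_\<phi>(2) [OF bilin_mod_cat_act [of "[]" v]] by simp
next
  case (Cons c u)
  then show ?case
    by (auto intro!: lin_mod_on_pairs [OF subspace_multilin] lin_mod_cat)
qed

lemma acts_multilin: "x \<in> M \<Longrightarrow> acts a x \<in> M"
  unfolding acts_def by (rule lin_ext_multilin [OF sc subspace_multilin lin_mod_act_word])

lemma acts_coset_cong: "coset M x = coset M y \<Longrightarrow> coset M (acts a x) = coset M (acts a y)"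
  by (rule coset_linear_cong [OF subspace_multilin subspace_multilin flinear_acts [OF flinear_id] acts_multilin])

lemma lin_mod_acts: "lin_mod sc M (\<lambda>a. acts a x)"
  unfolding acts_def by (rule lin_mod_lin_ext [OF subspace_multilin lin_mod_act])

lemma acts_Cons:
  "acts a (free_cat (basis [b]) x) = on_pairs (\<lambda>p q. free_cat (basis [p]) (acts q x)) (\<phi> a b)"
  by (rule flinear_eqI [of "\<lambda>x. acts a (free_cat (basis [b]) x)"])
    (auto intro!: flinear_acts flinear_free_cat flinear_on_pairs_fun)

lemma on_pairs_cat_cong:
  assumes "\<And>p q. coset M (h p q) = coset M (h' p q)"
  shows "coset M (on_pairs (\<lambda>p q. free_cat (k p q) (h p q)) z)
    = coset M (on_pairs (\<lambda>p q. free_cat (k p q) (h' p q)) z)"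
  by (intro on_pairs_cong subspace_multilin free_cat_coset_cong sc assms refl)

text \<open>In the step of the induction on \<open>v\<close>, both sides are values of one map, linear modulo \<open>M\<close> in
  three letters, on the two sides of the axiom of linear extended associative semigroups.\<close>

lemma acts_cat_act:
  "coset M (acts a (free_cat (act v b) (basis w)))
    = coset M (on_pairs (\<lambda>p q. free_cat (act v p) (act w q)) (\<phi> a b))"
proof (induction v arbitrary: a b)
  case Nil
  then show ?case
    using acts_Cons [of a b "basis w"] by simp
next
  case (Cons c v)
  define g where "g u = (if length u = 3
    then free_cat (basis [u ! 0]) (free_cat (act v (u ! 1)) (act w (u ! 2))) else 0)" for u
  have g: "lin_ext g (basis [p, q, r]) = free_cat (basis [p]) (free_cat (act v q) (act w r))" for p q r
    by (simp add: g_def)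
  have "lin_mod sc M (\<lambda>x. g (s @ [x] @ t))" for s t
  proof -
    \<comment> \<open>The default 0 of \<open>g\<close> settles every word whose length is not
      three; otherwise the varying letter has one of three positions.\<close>
    consider q r where "s = []" "t = [q, r]" | p r where "s = [p]" "t = [r]"
      | p q where "s = [p, q]" "t = []" | "length (s @ t) \<noteq> 2"
      by (cases s; cases "tl s"; cases t; cases "tl t") auto
    then show ?thesis
      using lin_mod_basis [of sc "[]" "[]"]
      by cases (auto simp: g_def intro!: lin_mod_cat lin_mod_act)
  qed
  note kernel = lin_ext_multilin_cong [OF sc subspace_multilin this]
  note push = on_pairs_push [of "\<lambda>x. lin_ext g (slot 1 _ x)"]
    on_pairs_push [of "\<lambda>x. lin_ext g (slot 0 _ x)"]
    on_pairs_push [of "\<lambda>x. lin_ext g (slot _ _ (slot _ _ x))"]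
    on_pairs_push [of "lin_ext g"]
  have "coset M (acts a (free_cat (act (c # v) b) (basis w))) =
    coset M (on_pairs (\<lambda>p q. on_pairs (\<lambda>r s. free_cat (basis [r])
      (acts s (free_cat (act v q) (basis w)))) (\<phi> a p)) (\<phi> b c))"
    by (simp add: on_pairs_push [of "\<lambda>x. acts a (free_cat x (basis w))"] flinear_acts
        flinear_free_cat free_cat_assoc acts_Cons)
  also have "\<dots> = coset M (on_pairs (\<lambda>p q. on_pairs (\<lambda>r s. free_cat (basis [r])
      (on_pairs (\<lambda>x y. free_cat (act v x) (act w y)) (\<phi> s q))) (\<phi> a p)) (\<phi> b c))"
    by (intro on_pairs_cong subspace_multilin on_pairs_cat_cong Cons.IH)
  \<comment> \<open>The three uses of \<open>\<phi>\<close> are on \<open>b, c\<close>, then on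
    \<open>a, p\<close>, then on \<open>s, q\<close>: slots 1, 0 and 1 of the word
    \<open>[a, b, c]\<close>.\<close>
  also have "\<dots> = coset M (lin_ext g (slot 1 \<phi> (slot 0 \<phi> (slot 1 \<phi> (basis [a, b, c])))))"
    by (simp only: slot_1_basis slot_0_basis \<phi>_free_on push g flinear_slot flinear_lin_ext_compose
      flinear_id on_pairs_push [of "free_cat (basis [_])"] flinear_free_cat)
  also have "\<dots> = coset M (lin_ext g (slot 0 \<phi> (slot 1 (\<lambda>a b. basis [b, a]) (slot 0 \<phi> (basis [a, b, c])))))"
    by (intro kernel \<phi>_slots) simp
  \<comment> \<open>On this side \<open>\<phi>\<close> is applied to \<open>a, b\<close>, the flip
    brings \<open>c\<close> next to \<open>p\<close>, and \<open>\<phi>\<close> is applied to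
    \<open>p, c\<close>; the letter \<open>q\<close> is left to act on \<open>w\<close>.\<close>
  also have "\<dots> = coset M (on_pairs (\<lambda>p q. on_pairs (\<lambda>r s.
      free_cat (basis [r]) (free_cat (act v s) (act w q))) (\<phi> p c)) (\<phi> a b))"
  proof -
    have "slot 1 (\<lambda>a b. basis [b, a]) (basis [p, q, c]) = (basis [p, c, q] :: 'a list \<Rightarrow>\<^sub>0 'k)" for p q
      by (subst slot_1_basis) auto
    then show ?thesis
    by (simp only: slot_0_basis \<phi>_free_on push g flinear_slot flinear_lin_ext_compose
      flinear_id)
  qed
  also have "\<dots> = coset M (on_pairs (\<lambda>p q. free_cat (act (c # v) p) (act w q)) (\<phi> a b))"
    by (simp add: on_pairs_push [of "\<lambda>x. free_cat x (act w _)"] flinear_free_cat free_cat_assoc)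
  finally show ?case .
qed

lemma acts_cat_acts:
  "coset M (acts a (free_cat (acts b x) (basis w)))
    = coset M (on_pairs (\<lambda>p q. free_cat (acts p x) (act w q)) (\<phi> a b))"
  by (rule coset_flinear_eqI [OF subspace_multilin])
    (auto intro!: flinear_acts flinear_free_cat flinear_on_pairs_fun simp: acts_cat_act)

section \<open>Insertion at a leaf\<close>

text \<open>\<open>ins i x w\<close> is the composition \<open>w \<circ>\<^sub>i x\<close> of the proposition, for an arbitrary second argument;
  it is \<open>0\<close> unless \<open>1 \<le> i \<le> length w + 1\<close>.\<close>

primrec ins :: "nat \<Rightarrow> ('a list \<Rightarrow>\<^sub>0 'k) \<Rightarrow> 'a list \<Rightarrow> ('a list \<Rightarrow>\<^sub>0 'k)" where
  "ins i x [] = (if i = 1 then x else 0)"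
| "ins i x (a # w) =
    (if i \<le> length w + 1 then free_cat (basis [a]) (ins i x w)
     else if i = length w + 2 then free_cat (acts a x) (basis w) else 0)"

definition inss :: "nat \<Rightarrow> ('a list \<Rightarrow>\<^sub>0 'k) \<Rightarrow> ('a list \<Rightarrow>\<^sub>0 'k) \<Rightarrow> ('a list \<Rightarrow>\<^sub>0 'k)" where
  "inss i x = lin_ext (ins i x)"

lemma flinear_inss: "flinear L \<Longrightarrow> flinear (\<lambda>y. inss i x (L y))"
  unfolding inss_def by (rule flinear_lin_ext_compose)

lemma inss_basis [simp]: "inss i x (basis w) = ins i x w"
  by (simp add: inss_def)

lemma lin_mod_ins: "lin_mod sc M (\<lambda>a. ins i x (u @ [a] @ v))"
proof (induction u)
  case Nil
  show ?case
    using lin_mod_basis [of sc "[]" "[]"]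
    by (cases "i \<le> length v + 1"; cases "i = length v + 2")
      (auto intro!: lin_mod_cat lin_mod_acts)
next
  case (Cons b u)
  then show ?case
    using lin_mod_basis [of sc u v]
    \<comment> \<open>Only the length of the word decides the branch, so \<open>undefined\<close>
      stands in for the varying letter.\<close>
    by (cases "i \<le> length (u @ [undefined] @ v) + 1"; cases "i = length (u @ [undefined] @ v) + 2")
      (auto intro!: lin_mod_cat)
qed

lemma inss_coset_cong: "coset M y = coset M z \<Longrightarrow> coset M (inss i x y) = coset M (inss i x z)"
  unfolding inss_def by (rule lin_ext_multilin_cong [OF sc subspace_multilin lin_mod_ins])

lemma ins_out_of_range: "i = 0 \<or> i > length w + 1 \<Longrightarrow> ins i x w = 0"
  by (induction w) auto

lemma inss_out_of_range:
  assumes "y \<in> free_on {w. length w = n}" "i = 0 \<or> i > n + 1"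
  shows "inss i x y = 0"
proof -
  have "inss i x y = lin_ext (\<lambda>w. 0) y"
    unfolding inss_def
    by (rule lin_ext_cong, rule ins_out_of_range) (use assms in \<open>auto simp: free_on_def\<close>)
  then show ?thesis
    by simp
qed

text \<open>The first \<open>length v + 1\<close> leaves of the comb of \<open>u @ v\<close> belong
  to the inner comb of \<open>v\<close>; insertion there leaves the outer letters untouched.\<close>

lemma ins_append_low: "i \<le> length v + 1 \<Longrightarrow> ins i x (u @ v) = free_cat (basis u) (ins i x v)"
  by (induction u) (auto simp flip: free_cat_assoc)

text \<open>The comb of \<open>u @ v\<close> is the comb of \<open>u\<close> with the comb of
  \<open>v\<close> plugged into its first leaf, which shifts every later leaf of \<open>u\<close> by
  \<open>length v\<close>.\<close>

lemma ins_append_high: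
  "i > length v + 1 \<Longrightarrow> ins i x (u @ v) = free_cat (ins (i - length v) x u) (basis v)"
proof (induction u)
  case Nil
  then show ?case by (auto simp: ins_out_of_range)
next
  case (Cons a u)
  then have "i \<le> length (u @ v) + 1 \<longleftrightarrow> i - length v \<le> length u + 1"
    "i = length (u @ v) + 2 \<longleftrightarrow> i - length v = length u + 2"
    by auto
  with Cons show ?case
    by (auto simp: free_cat_assoc)
qed

lemma inss_cat_low:
  assumes "z \<in> free_on {w. length w = n}" "i \<le> n + 1"
  shows "inss i x (free_cat y z) = free_cat y (inss i x z)"
proof (rule flinear_eqI [of "\<lambda>y. inss i x (free_cat y z)"])
  fix u
  show "inss i x (free_cat (basis u) z) = free_cat (basis u) (inss i x z)"
    by (rule flinear_eqI [of "\<lambda>z. inss i x (free_cat (basis u) z)"])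
      (use assms in \<open>auto intro!: flinear_inss flinear_free_cat ins_append_low simp: free_on_def\<close>)
qed (intro flinear_inss flinear_free_cat)+

lemma inss_cat_high:
  assumes "z \<in> free_on {w. length w = n}" "i > n + 1"
  shows "inss i x (free_cat y z) = free_cat (inss (i - n) x y) z"
proof (rule flinear_eqI [of "\<lambda>y. inss i x (free_cat y z)"])
  fix u
  show "inss i x (free_cat (basis u) z) = free_cat (inss (i - n) x (basis u)) z"
    by (rule flinear_eqI [of "\<lambda>z. inss i x (free_cat (basis u) z)"])
      (use assms in \<open>auto intro!: flinear_inss flinear_free_cat simp: free_on_def ins_append_high\<close>)
qed (intro flinear_inss flinear_free_cat)+

text \<open>Operadic associativity in disguise: as the action of \<open>a\<close> is composition at
  leaf 2 of \<open>a\<close>, leaf \<open>i\<close> of \<open>w\<close> becomes leaf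
  \<open>Suc i\<close> of the result.\<close>

lemma acts_ins:
  assumes "1 \<le> i" "i \<le> length w + 1"
  shows "coset M (acts a (ins i x w)) = coset M (inss (Suc i) x (act w a))"
  using assms
proof (induction w arbitrary: a)
  case Nil
  then show ?case by simp
next
  case (Cons b w)
  have inss: "inss (Suc i) x (act (b # w) a)
      = on_pairs (\<lambda>p q. inss (Suc i) x (free_cat (basis [p]) (act w q))) (\<phi> a b)"
    by (simp add: on_pairs_push [of "inss (Suc i) x"] flinear_inss flinear_id)
  show ?case
  proof (cases "i \<le> length w + 1")
    case True
    then have "inss (Suc i) x (free_cat (basis [p]) (act w q)) = free_cat (basis [p]) (inss (Suc i) x (act w q))" for p q
      by (intro inss_cat_low [OF act_free_on]) simp
    moreover have "coset M (on_pairs (\<lambda>p q. free_cat (basis [p]) (acts q (ins i x w))) (\<phi> a b))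
        = coset M (on_pairs (\<lambda>p q. free_cat (basis [p]) (inss (Suc i) x (act w q))) (\<phi> a b))"
      using Cons.IH Cons.prems True by (intro on_pairs_cat_cong) auto
    ultimately show ?thesis
      using True unfolding inss by (simp add: acts_Cons)
  next
    case False
    then have i: "i = length w + 2"
      using Cons.prems by simp
    then have "inss (Suc i) x (free_cat (basis [p]) (act w q)) = free_cat (acts p x) (act w q)" for p q
      by (subst inss_cat_high [OF act_free_on]) auto
    \<comment> \<open>At the last leaf \<open>b\<close> acts on \<open>x\<close> and then
      \<open>a\<close> acts on the outcome; \<open>acts_cat_acts\<close>, and with it the axiom on
      \<Phi>, exchanges the two actions.\<close>
    then show ?thesis
      using i acts_cat_acts [of a b x w] unfolding inss by simp
  qed
qed

lemma acts_inss:
  assumes "y \<in> free_on {w. length w = n}" "1 \<le> i" "i \<le> n + 1"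
  shows "coset M (acts a (inss i x y)) = coset M (inss (Suc i) x (acts a y))"
  by (rule coset_flinear_eqI [OF subspace_multilin])
    (use assms in \<open>auto intro!: flinear_inss flinear_acts flinear_id acts_ins simp: free_on_def\<close>)

end

section \<open>Straightening trees into left combs\<close>

lemma flinear_free_comp_left: "flinear L \<Longrightarrow> flinear (\<lambda>x. free_comp i (L x) y)"
  unfolding free_comp_def by (rule flinear_compose [OF flinear_bilin_ext_left])

lemma flinear_free_comp_right: "flinear L \<Longrightarrow> flinear (\<lambda>x. free_comp i y (L x))"
  unfolding free_comp_def by (rule flinear_compose [OF flinear_bilin_ext_right])

lemmas flinear_free_comp = flinear_free_comp_left flinear_free_comp_right flinear_id

lemma free_comp_basis:
  "free_comp i (basis t) (basis s) = (if 1 \<le> i \<and> i \<le> size1 t then basis (graft i t s) else 0)"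
  by (simp add: free_comp_def)

lemma subspace_operadic_ideal: "fs.subspace (operadic_ideal R)"
  unfolding fs.subspace_def by (blast intro: operadic_ideal.intros)

primrec left_comb :: "'a list \<Rightarrow> 'a tree" where
  "left_comb [] = Leaf"
| "left_comb (a # w) = Node (left_comb w) a Leaf"

lemma size1_left_comb [simp]: "size1 (left_comb w) = length w + 1"
  by (induction w) auto

lemma graft_left_comb: "graft (Suc 0) (left_comb u) (left_comb v) = left_comb (u @ v)"
  by (induction u) auto

definition comb_ext :: "('a list \<Rightarrow>\<^sub>0 'k::field) \<Rightarrow> ('a tree \<Rightarrow>\<^sub>0 'k)" where
  "comb_ext = lin_ext (\<lambda>w. basis (left_comb w))"

lemma comb_ext_basis [simp]: "comb_ext (basis w) = basis (left_comb w)"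
  by (simp add: comb_ext_def)

lemma flinear_comb_ext: "flinear L \<Longrightarrow> flinear (\<lambda>x. comb_ext (L x))"
  unfolding comb_ext_def by (rule flinear_lin_ext_compose)

lemma comb_ext_free_cat: "comb_ext (free_cat x y) = free_comp 1 (comb_ext x) (comb_ext y)"
proof (rule flinear_eqI [of "\<lambda>x. comb_ext (free_cat x y)"])
  fix u
  show "comb_ext (free_cat (basis u) y) = free_comp 1 (comb_ext (basis u)) (comb_ext y)"
    by (rule flinear_eqI [of "\<lambda>y. comb_ext (free_cat (basis u) y)"])
      (auto intro!: flinear_comb_ext flinear_free_cat flinear_free_comp
        simp: free_comp_basis graft_left_comb)
qed (intro flinear_comb_ext flinear_free_cat flinear_free_comp)+

context lEAS_rep
begin

abbreviation I :: "('a tree \<Rightarrow>\<^sub>0 'k) set" where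
  "I \<equiv> As_ideal sc \<Phi>"

lemma subspace_I: "fs.subspace I"
  unfolding As_ideal_def by (rule subspace_operadic_ideal)

text \<open>The tree \<open>Node l a r\<close> is (a \<circ> r at leaf 2) \<circ> l at leaf 1: the
  root letter acts on the straightened right subtree, and the left subtree is appended on the
  right.\<close>

primrec nf :: "'a tree \<Rightarrow> ('a list \<Rightarrow>\<^sub>0 'k)" where
  "nf Leaf = basis []"
| "nf (Node l a r) = free_cat (acts a (nf r)) (nf l)"

definition nfs :: "('a tree \<Rightarrow>\<^sub>0 'k) \<Rightarrow> ('a list \<Rightarrow>\<^sub>0 'k)" where
  "nfs = lin_ext nf"

lemma nfs_basis [simp]: "nfs (basis t) = nf t"
  by (simp add: nfs_def)

lemma flinear_nfs: "flinear L \<Longrightarrow> flinear (\<lambda>x. nfs (L x))"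
  unfolding nfs_def by (rule flinear_lin_ext_compose)

lemma nf_free_on: "nf t \<in> free_on {w. length w = size t}"
proof (induction t)
  case (Node l a r)
  then have "free_cat (acts a (nf r)) (nf l) \<in> free_on {w. length w = Suc (size r) + size l}"
    by (intro free_cat_in_free_on acts_free_on)
  then show ?case
    by (simp add: add.commute)
qed simp

lemma nfs_free_on:
  assumes "x \<in> free_on {t. size1 t = n}"
  shows "nfs x \<in> free_on {w. length w = n - 1}"
  unfolding nfs_def
proof (rule lin_ext_in_subspace [OF subspace_free_on])
  fix t
  assume "t \<in> Poly_Mapping.keys x"
  then have "size t = n - 1"
    using assms by (auto simp: free_on_def size1_size)
  then show "nf t \<in> free_on {w. length w = n - 1}"
    using nf_free_on [of t] by simp
qed

lemma nf_left_comb [simp]: "nf (left_comb w) = basis w"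
  by (induction w) auto

lemma nfs_comb_ext: "nfs (comb_ext x) = x"
  by (rule flinear_eqI [of "\<lambda>x. nfs (comb_ext x)"])
    (auto intro!: flinear_nfs flinear_comb_ext flinear_id)

text \<open>Going down from the root, a leaf in the left subtree only meets a concatenation, and a
  leaf in the right subtree is carried past the action of the root letter by
  \<open>acts_inss\<close>.\<close>

lemma nf_graft:
  assumes "1 \<le> i" "i \<le> size1 t"
  shows "coset M (nf (graft i t s)) = coset M (inss i (nf s) (nf t))"
  using assms
proof (induction t arbitrary: i)
  case Leaf
  then show ?case by simp
next
  case (Node l a r)
  show ?case
  proof (cases "i \<le> size1 l")
    case True
    then have IH: "coset M (nf (graft i l s)) = coset M (inss i (nf s) (nf l))"
      using Node by simp
    from True have "coset M (nf (graft i (Node l a r) s))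
        = coset M (free_cat (acts a (nf r)) (inss i (nf s) (nf l)))"
      by (simp add: free_cat_coset_cong [OF sc refl IH])
    also have "\<dots> = coset M (inss i (nf s) (nf (Node l a r)))"
      using inss_cat_low [OF nf_free_on] True by (simp add: size1_size)
    finally show ?thesis .
  next
    case False
    \<comment> \<open>The leaf of \<open>r\<close> in question. The index becomes
      \<open>Suc k\<close> in the first factor of the normal form because \<open>size1 l\<close> is
      \<open>size l + 1\<close>.\<close>
    define k where "k = i - size1 l"
    have k: "1 \<le> k" "k \<le> size1 r" "i - size l = Suc k" "i > size l + 1"
      using False Node.prems by (auto simp: k_def size1_size)
    have "coset M (acts a (nf (graft k r s))) = coset M (acts a (inss k (nf s) (nf r)))"
      using Node.IH(2) k by (intro acts_coset_cong) auto
    also have "\<dots> = coset M (inss (Suc k) (nf s) (acts a (nf r)))"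
      using k by (intro acts_inss [OF nf_free_on]) (auto simp: size1_size)
    finally have IH: "coset M (acts a (nf (graft k r s))) = coset M (inss (Suc k) (nf s) (acts a (nf r)))" .
    from False have "coset M (nf (graft i (Node l a r) s))
        = coset M (free_cat (inss (Suc k) (nf s) (acts a (nf r))) (nf l))"
      by (simp add: free_cat_coset_cong [OF sc IH refl] flip: k_def)
    also have "\<dots> = coset M (inss i (nf s) (nf (Node l a r)))"
      using inss_cat_high [OF nf_free_on k(4)] k by simp
    finally show ?thesis .
  qed
qed

section \<open>The operadic ideal is sent into the multilinearity relations\<close>

text \<open>By \<open>nf_graft\<close> the result depends on \<open>x\<close> only through
  \<open>nfs x\<close> modulo \<open>M\<close>; for a leaf out of range both sides vanish.\<close>

lemma nfs_comp_left:
  assumes "nfs x \<in> M"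
  shows "nfs (free_comp i x y) \<in> M"
proof -
  have "nfs (free_comp i x (basis s)) \<in> M" for s
  proof -
    have "coset M (nfs (free_comp i x (basis s))) = coset M (inss i (nf s) (nfs x))"
    proof (rule coset_flinear_eqI [OF subspace_multilin, of "\<lambda>x. nfs (free_comp i x (basis s))"])
      fix t
      show "coset M (nfs (free_comp i (basis t) (basis s))) = coset M (inss i (nf s) (nfs (basis t)))"
        using nf_graft [of i t s] inss_out_of_range [OF nf_free_on, of i t]
        by (auto simp: free_comp_basis size1_size flinear_zero [OF flinear_nfs [OF flinear_id]])
    qed (intro flinear_nfs flinear_inss flinear_free_comp)+
    also have "\<dots> = coset M (inss i (nf s) 0)"
      using assms by (intro inss_coset_cong) (simp add: coset_eq_iff subspace_multilin)
    finally show ?thesis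
      by (simp add: coset_eq_iff subspace_multilin inss_def)
  qed
  then show ?thesis
    using flinear_eq_lin_ext [of "\<lambda>y. nfs (free_comp i x y)" y]
    by (simp add: flinear_nfs flinear_free_comp lin_ext_in_subspace [OF subspace_multilin])
qed

text \<open>Along the path from the root to the chosen leaf, the grafted element passes only through
  actions of letters and concatenations, all of which are linear and preserve
  \<open>M\<close>.\<close>

lemma nfs_comp_right:
  assumes "nfs y \<in> M"
  shows "nfs (free_comp i x y) \<in> M"
proof -
  have graft: "lin_ext (\<lambda>s. nf (graft i t s)) y \<in> M" for i t
  proof (induction t arbitrary: i)
    case Leaf
    then show ?case
      using assms by (simp add: nfs_def)
  next
    case (Node l a r)
    show ?case
    proof (cases "i \<le> size1 l")
      case True
      then have "lin_ext (\<lambda>s. nf (graft i (Node l a r) s)) y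
          = free_cat (acts a (nf r)) (lin_ext (\<lambda>s. nf (graft i l s)) y)"
        by (simp add: flinear_push [of "free_cat _"] flinear_free_cat)
      then show ?thesis
        using Node.IH by (simp add: free_cat_multilin_right [OF sc])
    next
      case False
      then have "lin_ext (\<lambda>s. nf (graft i (Node l a r) s)) y
          = free_cat (acts a (lin_ext (\<lambda>s. nf (graft (i - size1 l) r s)) y)) (nf l)"
        by (simp add: flinear_push [of "\<lambda>x. free_cat (acts a x) (nf l)"] flinear_acts flinear_free_cat)
      then show ?thesis
        using Node.IH by (simp add: free_cat_multilin_left [OF sc] acts_multilin)
    qed
  qed
  have "nfs (free_comp i (basis t) y) \<in> M" for t
  proof -
    have "nfs (free_comp i (basis t) y) = lin_ext (\<lambda>s. nfs (free_comp i (basis t) (basis s))) y"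
      by (rule flinear_eq_lin_ext) (intro flinear_nfs flinear_free_comp)
    also have "\<dots> \<in> M"
      using graft [of i t] fs.subspace_0 [OF subspace_multilin]
      by (cases "1 \<le> i \<and> i \<le> size1 t")
        (auto simp: free_comp_basis flinear_zero [OF flinear_nfs [OF flinear_id]])
    finally show ?thesis .
  qed
  then show ?thesis
    using flinear_eq_lin_ext [of "\<lambda>x. nfs (free_comp i x y)" x]
    by (simp add: flinear_nfs flinear_free_comp lin_ext_in_subspace [OF subspace_multilin])
qed

text \<open>The two sides of a relation of the third family straighten to \<open>\<phi> a b\<close>
  and to \<open>f\<close>, both representatives of \<Phi>(a \<otimes> b).\<close>

lemma nfs_rels:
  assumes "x \<in> As_rels sc \<Phi>"
  shows "nfs x \<in> M"
proof -
  note lin = flinear_diff [OF flinear_nfs [OF flinear_id]] flinear_scale [OF flinear_nfs [OF flinear_id]]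
  have gens: "basis ([] @ [a + b] @ []) - basis ([] @ [a] @ []) - basis ([] @ [b] @ []) \<in> M"
    "basis ([] @ [sc c a] @ []) - fscale c (basis ([] @ [a] @ [])) \<in> M" for a b c
    unfolding multilin_def by (rule fs.span_base, blast)+
  have rel: "nfs (free_comp 2 (corolla a) (corolla b)
      - lin_ext (\<lambda>w. free_comp 1 (corolla (w ! 0)) (corolla (w ! 1))) f) \<in> M"
    if f: "f \<in> free_on {w. length w = 2}" "f \<in> \<Phi> (word sc [a, b])" for a b f
  proof -
    have "nfs (free_comp 2 (corolla a) (corolla b)) = \<phi> a b"
      by (simp add: free_comp_basis on_pairs_basis_id [OF \<phi>_free_on])
    moreover have "nfs (lin_ext (\<lambda>w. free_comp 1 (corolla (w ! 0)) (corolla (w ! 1))) f) = lin_ext basis f"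
      unfolding flinear_push [OF flinear_nfs [OF flinear_id]]
    proof (rule lin_ext_cong)
      fix w
      assume "w \<in> Poly_Mapping.keys f"
      then have "length w = 2"
        using f by (auto simp: free_on_def)
      then show "nfs (free_comp 1 (corolla (w ! 0)) (corolla (w ! 1))) = basis w"
        by (auto simp: free_comp_basis numeral_2_eq_2 length_Suc_conv)
    qed
    moreover have "\<phi> a b - f \<in> M"
      using f(2) unfolding \<Phi>_word mem_coset_iff [OF subspace_multilin]
      by (simp flip: coset_eq_iff [OF subspace_multilin])
    ultimately show ?thesis
      by (simp add: lin)
  qed
  from assms show ?thesis
    unfolding As_rels_def using gens rel by (auto simp: lin)
qed

lemma nfs_ideal: "x \<in> I \<Longrightarrow> nfs x \<in> M"
  unfolding As_ideal_def
proof (induction rule: operadic_ideal.induct)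
  case (gen x)
  then show ?case by (rule nfs_rels)
next
  case zero
  then show ?case by (simp add: nfs_def fs.subspace_0 subspace_multilin)
next
  case (add x y)
  then show ?case
    by (simp add: flinear_add [OF flinear_nfs [OF flinear_id]] fs.subspace_add subspace_multilin)
next
  case (scale x c)
  then show ?case
    by (simp add: flinear_scale [OF flinear_nfs [OF flinear_id]] fs.subspace_scale subspace_multilin)
qed (simp_all add: nfs_comp_left nfs_comp_right)

lemma nfs_coset_cong: "coset I x = coset I y \<Longrightarrow> coset M (nfs x) = coset M (nfs y)"
  by (rule coset_linear_cong [OF subspace_I subspace_multilin flinear_nfs [OF flinear_id] nfs_ideal])

section \<open>Left combs span the operad\<close>

lemma I_comp_left: "x \<in> I \<Longrightarrow> free_comp i x y \<in> I"
  and I_comp_right: "y \<in> I \<Longrightarrow> free_comp i x y \<in> I"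
  unfolding As_ideal_def by (rule operadic_ideal.comp_left operadic_ideal.comp_right, assumption)+

lemma free_comp_coset_cong:
  assumes x: "coset I x = coset I x'" and y: "coset I y = coset I y'"
  shows "coset I (free_comp i x y) = coset I (free_comp i x' y')"
proof -
  have "coset I (free_comp i x y) = coset I (free_comp i x' y)"
    by (rule coset_linear_cong [OF subspace_I subspace_I _ _ x])
      (intro flinear_free_comp I_comp_left, assumption?)+
  also have "\<dots> = coset I (free_comp i x' y')"
    by (rule coset_linear_cong [OF subspace_I subspace_I _ _ y])
      (intro flinear_free_comp I_comp_right, assumption?)+
  finally show ?thesis .
qed

lemma lin_mod_corolla: "lin_mod sc I corolla"
  unfolding lin_mod_def coset_eq_iff [OF subspace_I]
proof (intro allI)
  fix c a b
  have "corolla (sc c a + b) - corolla (sc c a) - corolla b \<in> I"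
    unfolding As_ideal_def As_rels_def by (rule operadic_ideal.gen) blast
  moreover have "corolla (sc c a) - fscale c (corolla a) \<in> I"
    unfolding As_ideal_def As_rels_def by (rule operadic_ideal.gen) blast
  ultimately show "corolla (sc c a + b) - (fscale c (corolla a) + corolla b) \<in> I"
    using fs.subspace_add [OF subspace_I] by (fastforce simp: algebra_simps)
qed

text \<open>The comb of \<open>u @ [a] @ v\<close> is an iterated composition at leaf 1 through the
  corolla of \<open>a\<close>, hence linear in \<open>a\<close> modulo \<open>I\<close>.\<close>

lemma comb_ext_multilin: "x \<in> M \<Longrightarrow> comb_ext x \<in> I"
  unfolding comb_ext_def
proof (rule lin_ext_multilin [OF sc subspace_I], goal_cases)
  case (1 u v)
  have "lin_mod sc I (\<lambda>a. free_comp 1 (basis (left_comb u)) (free_comp 1 (corolla a) (basis (left_comb v))))"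
    by (rule lin_mod_compose [OF lin_mod_corolla subspace_I subspace_I])
      (intro flinear_free_comp I_comp_left I_comp_right, assumption?)+
  moreover have "free_comp 1 (basis (left_comb u)) (free_comp 1 (corolla a) (basis (left_comb v)))
      = (basis (left_comb (u @ [a] @ v)) :: 'a tree \<Rightarrow>\<^sub>0 'k)" for a
    using graft_left_comb [of u "a # v"] by (simp add: free_comp_basis)
  ultimately show ?case
    by simp
qed

lemma comb_ext_coset_cong: "coset M x = coset M y \<Longrightarrow> coset I (comb_ext x) = coset I (comb_ext y)"
  by (rule coset_linear_cong [OF subspace_multilin subspace_I flinear_comb_ext [OF flinear_id] comb_ext_multilin])

text \<open>Each use of the defining relation moves the acting letter past one letter of the comb,
  which reproduces the recursion of \<open>act\<close>.\<close>

lemma comp_2_left_comb: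
  "coset I (free_comp 2 (corolla a) (basis (left_comb w))) = coset I (comb_ext (act w a))"
proof (induction w arbitrary: a)
  case Nil
  then show ?case
    by (simp add: free_comp_basis)
next
  case (Cons b w)
  let ?w = "basis (left_comb w) :: 'a tree \<Rightarrow>\<^sub>0 'k"
  have "free_comp 2 (corolla a) (corolla b)
      - lin_ext (\<lambda>w. free_comp 1 (corolla (w ! 0)) (corolla (w ! 1))) (\<phi> a b) \<in> I"
    unfolding As_ideal_def As_rels_def
    using \<phi>_free_on coset_self [OF subspace_multilin] \<Phi>_word by (intro operadic_ideal.gen) blast
  moreover have "lin_ext (\<lambda>w. free_comp 1 (corolla (w ! 0)) (corolla (w ! 1))) (\<phi> a b)
      = on_pairs (\<lambda>p q. free_comp 1 (corolla p) (corolla q)) (\<phi> a b)"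
    unfolding on_pairs_def by (rule lin_ext_cong) (use \<phi>_free_on in \<open>force simp: free_on_def\<close>)
  ultimately have rel: "coset I (free_comp 2 (corolla a) (corolla b))
      = coset I (on_pairs (\<lambda>p q. free_comp 1 (corolla p) (corolla q)) (\<phi> a b))"
    by (simp add: coset_eq_iff subspace_I)
  \<comment> \<open>Leaf 2 of a \<circ> b at leaf 2 is the left leaf of \<open>b\<close>, where the
    comb of \<open>w\<close> belongs.\<close>
  have "coset I (free_comp 2 (corolla a) (basis (left_comb (b # w))))
      = coset I (free_comp 2 (free_comp 2 (corolla a) (corolla b)) ?w)"
    by (simp add: free_comp_basis numeral_2_eq_2)
  also have "\<dots> = coset I (free_comp 2 (on_pairs (\<lambda>p q. free_comp 1 (corolla p) (corolla q)) (\<phi> a b)) ?w)"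
    by (rule free_comp_coset_cong [OF rel refl])
  also have "\<dots> = coset I (on_pairs (\<lambda>p q. free_comp 2 (free_comp 1 (corolla p) (corolla q)) ?w) (\<phi> a b))"
    by (simp add: on_pairs_push [of "\<lambda>x. free_comp 2 x ?w"] flinear_free_comp)
  \<comment> \<open>Leaf 2 of p \<circ> q at leaf 1 is the right leaf of \<open>q\<close>, so
    \<open>q\<close> acts on the comb of \<open>w\<close> next.\<close>
  also have "\<dots> = coset I (on_pairs (\<lambda>p q. free_comp 1 (corolla p) (free_comp 2 (corolla q) ?w)) (\<phi> a b))"
    by (simp add: free_comp_basis numeral_2_eq_2)
  also have "\<dots> = coset I (on_pairs (\<lambda>p q. free_comp 1 (corolla p) (comb_ext (act w q))) (\<phi> a b))"
    by (intro on_pairs_cong subspace_I free_comp_coset_cong refl Cons.IH)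
  also have "\<dots> = coset I (comb_ext (act (b # w) a))"
    by (simp add: on_pairs_push [of comb_ext] flinear_comb_ext flinear_id comb_ext_free_cat)
  finally show ?case .
qed

lemma comb_ext_nf: "coset I (comb_ext (nf t)) = coset I (basis t)"
proof (induction t)
  case Leaf
  then show ?case by simp
next
  case (Node l a r)
  have "coset I (basis (Node l a r)) = coset I (free_comp 1 (free_comp 2 (corolla a) (basis r)) (basis l))"
    by (simp add: free_comp_basis numeral_2_eq_2)
  also have "\<dots> = coset I (free_comp 1 (free_comp 2 (corolla a) (comb_ext (nf r))) (comb_ext (nf l)))"
    by (intro free_comp_coset_cong refl) (simp_all add: Node.IH)
  also have "\<dots> = coset I (free_comp 1 (comb_ext (acts a (nf r))) (comb_ext (nf l)))"
  proof (intro free_comp_coset_cong refl)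
    show "coset I (free_comp 2 (corolla a) (comb_ext (nf r))) = coset I (comb_ext (acts a (nf r)))"
      by (rule coset_flinear_eqI [OF subspace_I, of "\<lambda>x. free_comp 2 (corolla a) (comb_ext x)"])
        (auto intro!: flinear_free_comp flinear_comb_ext flinear_acts simp: comp_2_left_comb)
  qed
  finally show ?case
    by (simp add: comb_ext_free_cat)
qed

text \<open>Together with \<open>nfs_comb_ext\<close> this makes the maps induced by
  \<open>comb_ext\<close> and \<open>nfs\<close> on the quotients inverse to each other.\<close>

lemma comb_ext_nfs: "coset I (comb_ext (nfs x)) = coset I x"
  by (rule coset_flinear_eqI [OF subspace_I, of "\<lambda>x. comb_ext (nfs x)" "\<lambda>x. x"])
    (auto intro!: flinear_comb_ext flinear_nfs flinear_id simp: comb_ext_nf)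

section \<open>The isomorphism and the composition of words\<close>

definition to_tensor :: "('a tree \<Rightarrow>\<^sub>0 'k) set \<Rightarrow> ('a, 'k) tensor" where
  "to_tensor X = (\<Union>x\<in>X. coset M (nfs x))"

lemma to_tensor_coset [simp]: "to_tensor (coset I x) = coset M (nfs x)"
  unfolding to_tensor_def by (rule UN_coset_map [OF subspace_I nfs_coset_cong])

lemma qiso_to_tensor:
  assumes "n \<ge> 1"
  shows "qiso I (As sc \<Phi> n) M (tensor_power sc (n - 1)) to_tensor"
proof -
  have into: "to_tensor ` As sc \<Phi> n \<subseteq> tensor_power sc (n - 1)"
    using nfs_free_on by (auto simp: As_def tensor_power_def)
  have onto: "tensor_power sc (n - 1) \<subseteq> to_tensor ` As sc \<Phi> n"
  proof
    fix Z
    assume "Z \<in> tensor_power sc (n - 1)"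
    then obtain z where z: "z \<in> free_on {w. length w = n - 1}" "Z = coset M z"
      by (auto simp: tensor_power_def)
    \<comment> \<open>A comb with \<open>n - 1\<close> letters has \<open>n\<close> leaves because
      \<open>n\<close> is positive.\<close>
    have "comb_ext z \<in> free_on {t. size1 t = n}"
      unfolding comb_ext_def
      by (rule lin_ext_in_subspace [OF subspace_free_on]) (use z assms in \<open>auto simp: free_on_def basis_def\<close>)
    then have "coset I (comb_ext z) \<in> As sc \<Phi> n"
      by (simp add: As_def)
    then show "Z \<in> to_tensor ` As sc \<Phi> n"
      using z by (force simp: nfs_comb_ext intro!: rev_image_eqI)
  qed
  have "inj_on to_tensor (As sc \<Phi> n)"
  proof (rule inj_onI)
    fix X Y
    assume "X \<in> As sc \<Phi> n" "Y \<in> As sc \<Phi> n" "to_tensor X = to_tensor Y"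
    then obtain x y where "X = coset I x" "Y = coset I y" "coset M (nfs x) = coset M (nfs y)"
      by (auto simp: As_def)
    then show "X = Y"
      using comb_ext_coset_cong [of "nfs x" "nfs y"] by (simp add: comb_ext_nfs)
  qed
  moreover have "qlinear I (As sc \<Phi> n) M (tensor_power sc (n - 1)) to_tensor"
    using into unfolding qlinear_def
    by (auto simp: As_def qadd_coset qscale_coset subspace_I subspace_multilin
        flinear_add [OF flinear_nfs [OF flinear_id]] flinear_scale [OF flinear_nfs [OF flinear_id]])
  ultimately show ?thesis
    using into onto by (auto simp: qiso_def bij_betw_def)
qed

lemma As_comp_coset: "As_comp sc \<Phi> i (coset I x) (coset I y) = coset I (free_comp i x y)"
proof -
  have "(\<Union>y'\<in>coset I y. coset I (free_comp i x' y')) = coset I (free_comp i x' y)" for x'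
    by (rule UN_coset_map [OF subspace_I]) (rule free_comp_coset_cong [OF refl])
  then show ?thesis
    unfolding As_comp_def
    by (simp, intro UN_coset_map [OF subspace_I] free_comp_coset_cong [OF _ refl])
qed

lemma to_tensor_comp:
  assumes X: "X \<in> As sc \<Phi> m" "to_tensor X = word sc u" and Y: "Y \<in> As sc \<Phi> n" "to_tensor Y = word sc v"
    and i: "1 \<le> i" "i \<le> length u + 1"
  shows "to_tensor (As_comp sc \<Phi> i X Y) = coset M (ins i (basis v) u)"
proof -
  \<comment> \<open>A class with image \<open>word sc w\<close> is the class of the left comb of
    \<open>w\<close>, so the composition can be computed on combs.\<close>
  have rep: "\<exists>x. Z = coset I x \<and> coset I x = coset I (basis (left_comb w))"
    if "Z \<in> As sc \<Phi> k" "to_tensor Z = word sc w" for Z w k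
  proof -
    obtain x where x: "Z = coset I x" "coset M (nfs x) = coset M (basis w)"
      using \<open>Z \<in> As sc \<Phi> k\<close> \<open>to_tensor Z = word sc w\<close> by (auto simp: As_def word_def)
    then show ?thesis
      using comb_ext_coset_cong [of "nfs x" "basis w"] by (auto simp: comb_ext_nfs)
  qed
  have "As_comp sc \<Phi> i X Y = coset I (free_comp i (basis (left_comb u)) (basis (left_comb v)))"
    using rep [OF X] rep [OF Y] by (auto simp: As_comp_coset)
  then have "to_tensor (As_comp sc \<Phi> i X Y) = coset M (nf (graft i (left_comb u) (left_comb v)))"
    using i by (simp add: free_comp_basis)
  also have "\<dots> = coset M (ins i (basis v) u)"
    using nf_graft [of i "left_comb u" "left_comb v"] i by simp
  finally show ?thesis .
qed

section \<open>The bracket as a product of slots\<close>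

text \<open>The prefix \<open>u\<close> makes the induction work: slot \<open>m\<close> turns the
  acting letter and the next one into \<open>p\<close> and \<open>q\<close>; then \<open>p\<close>
  joins the prefix, and \<open>q\<close> acts on the rest from slot \<open>Suc m\<close> on.\<close>

lemma fold_slot:
  "length u = m \<Longrightarrow> fold (\<lambda>j. slot j \<phi>) [m..<m + length v] (basis (u @ a # v)) = free_cat (basis u) (act v a)"
proof (induction v arbitrary: u m a)
  case Nil
  then show ?case by simp
next
  case (Cons b v)
  let ?f = "fold (\<lambda>j. slot j \<phi>) [Suc m..<Suc m + length v]"
  have lin: "flinear (fold (\<lambda>j. slot j \<phi>) js)" for js
  proof (induction js)
    case (Cons j js)
    show ?case
      using flinear_compose [OF Cons flinear_slot [OF flinear_id]] by (simp add: comp_def)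
  qed (simp add: id_def flinear_id)
  have "slot m \<phi> (basis (u @ a # b # v)) = on_pairs (\<lambda>p q. basis (u @ p # q # v)) (\<phi> a b)"
  proof -
    have "slot m \<phi> (basis (u @ a # b # v))
        = free_cat (basis u) (free_cat (on_pairs (\<lambda>p q. basis [p, q]) (\<phi> a b)) (basis v))"
      using slot_basis [OF Cons.prems, of \<phi> a b v] by (simp add: on_pairs_basis_id [OF \<phi>_free_on])
    then show ?thesis
      by (simp add: on_pairs_push [of "\<lambda>x. free_cat (basis u) (free_cat x (basis v))"] flinear_free_cat)
  qed
  then have "fold (\<lambda>j. slot j \<phi>) [m..<m + length (b # v)] (basis (u @ a # b # v))
      = ?f (on_pairs (\<lambda>p q. basis ((u @ [p]) @ q # v)) (\<phi> a b))"
    by (simp add: upt_conv_Cons del: upt_Suc)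
  also have "\<dots> = on_pairs (\<lambda>p q. ?f (basis ((u @ [p]) @ q # v))) (\<phi> a b)"
    by (rule on_pairs_push [OF lin])
  also have "\<dots> = on_pairs (\<lambda>p q. free_cat (basis (u @ [p])) (act v q)) (\<phi> a b)"
    by (subst Cons.IH) (use Cons.prems in auto)
  also have "\<dots> = free_cat (basis u) (act (b # v) a)"
    by (simp add: on_pairs_push [of "free_cat (basis u)"] flinear_free_cat flip: free_cat_assoc)
  finally show ?case .
qed

lemma fold_at_slot:
  "fold (\<lambda>j. at_slot sc j \<Phi>) [0..<length v] (word sc (a # v)) = coset M (act v a)"
proof -
  have "fold (\<lambda>j. at_slot sc j \<Phi>) js (coset M x) = coset M (fold (\<lambda>j. slot j \<phi>) js x)" for js x
    by (induction js arbitrary: x) (simp_all add: at_slot_coset [OF sc \<phi>_bilin \<Phi>_word])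
  then show ?thesis
    using fold_slot [of "[]" 0 v a] by (simp add: word_def)
qed

end

text \<open>In the comb with innermost letter \<open>a 1\<close>, the right leaf of
  \<open>a (i - 1)\<close> is leaf \<open>i\<close>; this singles out the letter that acts on an
  inserted word.\<close>

lemma letters_split:
  assumes "2 \<le> i" "i \<le> k + 1"
  shows "letters a k 1 = letters a k i @ a (i - 1) # letters a (i - 2) 1"
proof -
  obtain m where i: "i = 2 + m"
    using assms(1) le_Suc_ex by blast
  obtain d where k: "k = Suc m + d"
    using assms(2) i le_Suc_ex [of "Suc m" k] by auto
  have "[1..<Suc k] = [1..<Suc m] @ Suc m # [Suc (Suc m)..<Suc k]"
    using upt_add_eq_append [of 1 "Suc m" "Suc d"] upt_conv_Cons [of "Suc m" "Suc k"]
    by (simp add: k del: upt_Suc)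
  then show ?thesis
    by (simp add: letters_def i del: upt_Suc)
qed

lemma length_letters: "length (letters a p q) = Suc p - q"
  by (simp add: letters_def del: upt_Suc)

text \<open>Here the inserted word is appended on the right when i = 1, and slot 0 is applied first
  in the bracket. Both orders are the reverse of those in the informal formulas, and they are the
  ones fitting left combs, as explained with \<open>letters\<close>.\<close>

theorem proposition3p8:
  fixes sc :: "'k::field \<Rightarrow> 'a::ab_group_add \<Rightarrow> 'a"
    and \<Phi> :: "('a, 'k) tensor \<Rightarrow> ('a, 'k) tensor"
  assumes "lEAS sc \<Phi>"
  shows "\<exists>\<theta> :: nat \<Rightarrow> ('a tree \<Rightarrow>\<^sub>0 'k) set \<Rightarrow> ('a, 'k) tensor.
    (\<forall>n\<ge>1. qiso (As_ideal sc \<Phi>) (As sc \<Phi> n) (multilin sc) (tensor_power sc (n - 1)) (\<theta> n)) \<and>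
    \<theta> 1 (As_unit sc \<Phi>) = word sc [] \<and>
    (\<forall>a. \<theta> 2 (As_gen sc \<Phi> a) = word sc [a]) \<and>
    (\<forall>k l. \<forall>a b :: nat \<Rightarrow> 'a. \<forall>i\<in>{1..k + 1}. \<forall>X\<in>As sc \<Phi> (k + 1). \<forall>Y\<in>As sc \<Phi> (l + 1).
      \<theta> (k + 1) X = word sc (letters a k 1) \<longrightarrow>
      \<theta> (l + 1) Y = word sc (letters b l 1) \<longrightarrow>
      \<theta> (k + l + 1) (As_comp sc \<Phi> i X Y) =
        (if i = 1 then word sc (letters a k 1 @ letters b l 1)
         else tcat sc (word sc (letters a k i))
                (tcat sc (fold (\<lambda>j. at_slot sc j \<Phi>) [0..<l]
                            (word sc (a (i - 1) # letters b l 1)))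
                   (word sc (letters a (i - 2) 1)))))"
proof -
  obtain \<phi> where "lEAS_rep sc \<Phi> \<phi>"
    using lEAS_imp_rep [OF assms] by blast
  then interpret lEAS_rep sc \<Phi> \<phi> .
  show ?thesis
  \<comment> \<open>One map on cosets serves all arities, so the family is constant in
    \<open>n\<close>.\<close>
  proof (intro exI [of _ "\<lambda>n. to_tensor"] conjI allI ballI impI)
    fix n :: nat
    assume "1 \<le> n"
    then show "qiso I (As sc \<Phi> n) M (tensor_power sc (n - 1)) to_tensor"
      by (rule qiso_to_tensor)
  next
    show "to_tensor (As_unit sc \<Phi>) = word sc []"
      by (simp add: As_unit_def word_def)
  next
    fix a
    show "to_tensor (As_gen sc \<Phi> a) = word sc [a]"
      by (simp add: As_gen_def word_def)
  next
    fix k l i :: nat and a b :: "nat \<Rightarrow> 'a" and X Y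
    let ?v = "letters b l 1"
    assume i: "i \<in> {1..k + 1}" and "X \<in> As sc \<Phi> (k + 1)" "Y \<in> As sc \<Phi> (l + 1)"
      "to_tensor X = word sc (letters a k 1)" "to_tensor Y = word sc ?v"
    then have comp: "to_tensor (As_comp sc \<Phi> i X Y) = coset M (ins i (basis ?v) (letters a k 1))"
      by (intro to_tensor_comp) (auto simp: length_letters)
    show "to_tensor (As_comp sc \<Phi> i X Y) =
        (if i = 1 then word sc (letters a k 1 @ ?v)
         else tcat sc (word sc (letters a k i))
                (tcat sc (fold (\<lambda>j. at_slot sc j \<Phi>) [0..<l] (word sc (a (i - 1) # ?v)))
                   (word sc (letters a (i - 2) 1))))"
    proof (cases "i = 1")
      case True
      then show ?thesis
        using comp ins_append_low [of i "[]" "basis ?v" "letters a k 1"] by (simp add: word_def)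
    next
      case False
      then have i: "2 \<le> i" "i \<le> k + 1"
        using i by auto
      have "ins i (basis ?v) (letters a k 1) = free_cat (basis (letters a k i))
          (ins i (basis ?v) (a (i - 1) # letters a (i - 2) 1))"
        unfolding letters_split [OF i] using i by (intro ins_append_low) (simp add: length_letters)
      also have "\<dots> = free_cat (basis (letters a k i))
          (free_cat (act ?v (a (i - 1))) (basis (letters a (i - 2) 1)))"
        \<comment> \<open>Writing \<open>i\<close> as 2 plus the length of the tail selects the
          branch of \<open>ins\<close> in which the first letter acts.\<close>
        using le_Suc_ex [OF i(1)] by (auto simp: length_letters)
      finally show ?thesis
        using False fold_at_slot [of ?v "a (i - 1)"]
        by (simp add: comp length_letters word_def tcat_coset [OF sc])
    qed
  qed
qed

end
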